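(* Under the standing assumptions below, the process $(\zeta_t,t\ge0)$ is an $\mathbb F^\zeta$-Markov process: for all $t,h\ge0$ and every bounded measurable $f:\mathbb R\to\mathbb R$, $$\mathbb E[f(\zeta_{t+h})\mid\mathcal F^\zeta_t]=\mathbb E[f(\zeta_{t+h})\mid\zeta_t]\quad\mathbb P\text{-a.s.}$$
   Context: $\gamma$ a standard gamma process (driftless subordinator, $\gamma_0=0$, càdlàg, $\mathbb E[e^{-\lambda\gamma_t}]=(1+\lambda)^{-t}$) on a complete probability space $(\Omega,\mathcal F,\mathbb P)$; $\tau:\Omega\to(0,\infty)$ a random variable independent of $\gamma$; $\zeta_t=\gamma_{t\wedge\tau}/\gamma_\tau$, $t\ge0$; $\mathcal F^\zeta_t=\sigma(\zeta_s,s\le t)$. *)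

theory Defs
  imports "HOL-Probability.Probability"
begin

definition gen_sigma :: "'a measure \<Rightarrow> ('i \<Rightarrow> 'a \<Rightarrow> real) \<Rightarrow> 'i set \<Rightarrow> 'a measure" where
  "gen_sigma M X I =
     sigma (space M) (\<Union>s\<in>I. {X s -` A \<inter> space M | A. A \<in> sets (borel :: real measure)})"

definition std_gamma_process :: "'a measure \<Rightarrow> (real \<Rightarrow> 'a \<Rightarrow> real) \<Rightarrow> bool" where
  "std_gamma_process M \<gamma> \<longleftrightarrow>
     prob_space M \<and>
     (\<forall>t\<ge>0. \<gamma> t \<in> borel_measurable M) \<and>
     (\<forall>\<omega>\<in>space M. \<gamma> 0 \<omega> = 0) \<and>
     (\<forall>\<omega>\<in>space M. mono_on {0..} (\<lambda>t. \<gamma> t \<omega>)) \<and>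
     (\<forall>\<omega>\<in>space M. \<forall>t\<ge>0. continuous (at_right t) (\<lambda>s. \<gamma> s \<omega>) \<and>
        (t > 0 \<longrightarrow> (\<exists>l. ((\<lambda>s. \<gamma> s \<omega>) \<longlongrightarrow> l) (at_left t)))) \<and>
     (\<forall>(n::nat) (ts::nat \<Rightarrow> real). 0 \<le> ts 0 \<and> (\<forall>i<n. ts i \<le> ts (Suc i)) \<longrightarrow>
        prob_space.indep_vars M (\<lambda>_. borel) (\<lambda>i \<omega>. \<gamma> (ts (Suc i)) \<omega> - \<gamma> (ts i) \<omega>) {..<n}) \<and>
     (\<forall>s h. 0 \<le> s \<longrightarrow> 0 \<le> h \<longrightarrow>
        distr M borel (\<lambda>\<omega>. \<gamma> (s + h) \<omega> - \<gamma> s \<omega>) = distr M borel (\<gamma> h)) \<and>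
     (\<forall>l t. 0 \<le> l \<longrightarrow> 0 \<le> t \<longrightarrow>
        prob_space.expectation M (\<lambda>\<omega>. exp (- l * \<gamma> t \<omega>)) = (1 + l) powr (- t))"

definition zeta :: "(real \<Rightarrow> 'a \<Rightarrow> real) \<Rightarrow> ('a \<Rightarrow> real) \<Rightarrow> real \<Rightarrow> 'a \<Rightarrow> real" where
  "zeta \<gamma> \<tau> t \<omega> = \<gamma> (min t (\<tau> \<omega>)) \<omega> / \<gamma> (\<tau> \<omega>) \<omega>"

end

theory Submission
  imports Defs
begin

text \<open>
  Weighting the law of an increment of \<open>\<gamma>\<close> by \<open>exp (- l x)\<close> has the same effect as dividing the increment
  by \<open>1 + l\<close>. Ratios do not see this rescaling, so uniqueness of Laplace transforms makes the ratios
  \<open>\<gamma> s / \<gamma> t\<close>, \<open>s \<le> t\<close>, independent of \<open>\<gamma> t\<close>, hence also of the triple formed by \<open>\<gamma> t\<close>, the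
  increments of \<open>\<gamma>\<close> after \<open>t\<close> and \<open>\<tau>\<close>. On \<open>{t < \<tau>}\<close> the past of \<open>\<zeta>\<close> is \<open>\<zeta> s = (\<gamma> s / \<gamma> t) * \<zeta> t\<close>,
  while \<open>\<zeta> t\<close> and \<open>\<zeta> (t + h)\<close> are functions of this triple; so beyond \<open>\<zeta> t\<close> the past contributes only
  independent information. On \<open>{\<tau> \<le> t}\<close>, which is almost surely \<open>{\<zeta> t = 1}\<close>, the process has stopped at 1.
\<close>

section \<open>Generated sigma-algebras and conditioning\<close>

text \<open>The obstacle is exactness. The sigma-algebras \<open>gen_sigma\<close> contain no extra
  null sets, whereas \<open>t < \<tau> \<omega>\<close> matches
  \<open>zeta \<gamma> \<tau> t \<omega> \<noteq> 1\<close> only almost surely, and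
  \<open>zeta\<close> is 0 where \<open>\<gamma> (\<tau> \<omega>) \<omega> = 0\<close>. So the
  event \<open>L\<close> of \<open>t < \<tau>\<close> need not belong to the past of
  \<open>zeta\<close>, and \<open>zeta\<close> at \<open>t\<close> need not be measurable for the
  triple. The proof therefore uses a surrogate \<open>z'\<close> that is a function of the triple
  and agrees with \<open>zeta\<close> at \<open>t\<close> on \<open>L\<close>; it compares
  sigma-algebras only through their traces on \<open>L\<close> and discards null sets only under
  integrals. The rescaling comes from \<open>1 + (l + n) = (1 + l) * (1 + n / (1 + l))\<close>
  inside the Laplace transform \<open>(1 + l) powr (- u)\<close>. The factor \<open>1 + l\<close>
  does not depend on the length \<open>u\<close>, so all increments of a mesh rescale together and
  their ratios survive. Instead of computing a transition law, the proof takes \<open>g\<close>, the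
  conditional expectation given \<open>zeta\<close> at \<open>t\<close>, and shows that the error
  \<open>f (zeta \<gamma> \<tau> (t + h) \<omega>) - g \<omega>\<close> has integral zero over every
  event of the past.\<close>

lemma space_gen_sigma [simp]: "space (gen_sigma M X I) = space M"
  unfolding gen_sigma_def by (rule space_measure_of) auto

lemma sets_gen_sigma:
  "sets (gen_sigma M X I) =
     sigma_sets (space M) (\<Union>s\<in>I. {X s -` A \<inter> space M | A. A \<in> sets (borel :: real measure)})"
  unfolding gen_sigma_def by (rule sets_measure_of) auto

lemma measurable_gen_sigma: "s \<in> I \<Longrightarrow> X s \<in> borel_measurable (gen_sigma M X I)"
  by (rule measurableI) (auto simp: sets_gen_sigma intro!: sigma_sets.Basic)

lemma sets_gen_sigma_le:
  assumes "space N = space M" "\<And>s. s \<in> I \<Longrightarrow> X s \<in> borel_measurable N"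
  shows "sets (gen_sigma M X I) \<subseteq> sets N"
  unfolding sets_gen_sigma assms(1)[symmetric]
  by (rule sets.sigma_sets_subset) (auto intro!: measurable_sets[OF assms(2)])

lemma subalgebra_gen_sigma:
  assumes "\<And>s. s \<in> I \<Longrightarrow> X s \<in> borel_measurable M"
  shows "subalgebra M (gen_sigma M X I)"
  unfolding subalgebra_def using sets_gen_sigma_le[of M M I X] assms by auto

text \<open>The preimages under one map already form a sigma-algebra. This makes every event of a
  single variable an explicit preimage, which later allows one variable to be exchanged for another
  that agrees with it on part of the space.\<close>

lemma sets_gen_sigma_singleton:
  "sets (gen_sigma M X {t}) = {X t -` A \<inter> space M | A. A \<in> sets borel}"
proof -
  have "{X t -` A \<inter> space M | A. A \<in> sets borel} = sets (vimage_algebra (space M) (X t) borel)"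
    by (simp add: sets_vimage_algebra2)
  then show ?thesis
    unfolding sets_gen_sigma using sets.sigma_sets_eq[of "vimage_algebra (space M) (X t) borel"] by simp
qed

section \<open>Finite-dimensional cylinder events\<close>

text \<open>A pi-system generating \<open>gen_sigma\<close>: independence of whole processes reduces
  to finitely many times at once.\<close>

definition rectangles :: "'a measure \<Rightarrow> ('i \<Rightarrow> 'a \<Rightarrow> real) \<Rightarrow> 'i set \<Rightarrow> 'a set set" where
  "rectangles M X I =
     {{\<omega> \<in> space M. \<forall>s\<in>J. X s \<omega> \<in> A s} | J A. finite J \<and> J \<subseteq> I \<and> (\<forall>s. A s \<in> sets borel)}"

lemma Int_stable_rectangles: "Int_stable (rectangles M X I)"
proof (rule Int_stableI)
  fix a b assume "a \<in> rectangles M X I" "b \<in> rectangles M X I"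
  then obtain J A J' A' where a: "a = {\<omega> \<in> space M. \<forall>s\<in>J. X s \<omega> \<in> A s}" "finite J" "J \<subseteq> I" "\<forall>s. A s \<in> sets borel"
    and b: "b = {\<omega> \<in> space M. \<forall>s\<in>J'. X s \<omega> \<in> A' s}" "finite J'" "J' \<subseteq> I" "\<forall>s. A' s \<in> sets borel"
    unfolding rectangles_def by auto
  show "a \<inter> b \<in> rectangles M X I"
    unfolding rectangles_def
    \<comment> \<open>Padding with \<open>UNIV\<close> brings both rectangles to the common index
      set without adding a constraint.\<close>
    by (rule CollectI, rule exI[of _ "J \<union> J'"],
        rule exI[of _ "\<lambda>s. (if s \<in> J then A s else UNIV) \<inter> (if s \<in> J' then A' s else UNIV)"])
       (use a b in auto)
qed

lemma rectangles_sets: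
  assumes "space N = space M" "\<And>s. s \<in> I \<Longrightarrow> X s \<in> borel_measurable N"
  shows "rectangles M X I \<subseteq> sets N"
proof
  fix a assume "a \<in> rectangles M X I"
  then obtain J A where a: "a = {\<omega> \<in> space M. \<forall>s\<in>J. X s \<omega> \<in> A s}" "finite J" "J \<subseteq> I" "\<forall>s. A s \<in> sets borel"
    unfolding rectangles_def by auto
  have "{\<omega> \<in> space N. \<forall>s\<in>J. X s \<omega> \<in> A s} \<in> sets N"
  proof (rule sets.sets_Collect_finite_All)
    show "{\<omega> \<in> space N. X s \<omega> \<in> A s} \<in> sets N" if "s \<in> J" for s
    proof -
      have "X s \<in> borel_measurable N" "A s \<in> sets borel" using a that assms(2) by auto
      then show ?thesis by measurable
    qed
  qed (use a in auto)
  then show "a \<in> sets N" using a assms by simp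
qed

lemma sets_gen_sigma_rectangles:
  "sets (gen_sigma M X I) = sigma_sets (space M) (rectangles M X I)"
proof
  show "sigma_sets (space M) (rectangles M X I) \<subseteq> sets (gen_sigma M X I)"
    using rectangles_sets[of "gen_sigma M X I" M I X]
      sets.sigma_sets_subset[of "rectangles M X I" "gen_sigma M X I"]
    by (auto simp: measurable_gen_sigma)
  have "X s -` A \<inter> space M \<in> rectangles M X I" if "s \<in> I" "A \<in> sets borel" for s A
    unfolding rectangles_def
    by (rule CollectI, rule exI[of _ "{s}"], rule exI[of _ "\<lambda>_. A"]) (use that in auto)
  then show "sets (gen_sigma M X I) \<subseteq> sigma_sets (space M) (rectangles M X I)"
    unfolding sets_gen_sigma by (intro sigma_sets_mono') auto
qed

section \<open>Sampling at random times, and uniqueness of Laplace transforms\<close>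

text \<open>\<open>T\<close> is approximated from above by grid-valued times; sampling at those is a
  countable case distinction, and right continuity gives the limit. The measure space
  \<open>N\<close> is arbitrary because \<open>after_alg\<close> is needed as well as
  \<open>M\<close>.\<close>

lemma measurable_right_continuous_at_random_time:
  fixes X :: "real \<Rightarrow> 'a \<Rightarrow> real"
  assumes X: "\<And>u. 0 \<le> u \<Longrightarrow> X u \<in> borel_measurable N"
    and T: "T \<in> borel_measurable N" and T0: "\<And>\<omega>. \<omega> \<in> space N \<Longrightarrow> 0 \<le> T \<omega>"
    and cont: "\<And>\<omega> u. \<omega> \<in> space N \<Longrightarrow> 0 \<le> u \<Longrightarrow> continuous (at_right u) (\<lambda>s. X s \<omega>)"
  shows "(\<lambda>\<omega>. X (T \<omega>) \<omega>) \<in> borel_measurable N"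
proof -
  \<comment> \<open>The added 1 puts the grid point strictly above \<open>T\<close>, so the
    convergence is along \<open>at_right\<close>.\<close>
  define T' where "T' k \<omega> = (real_of_int \<lfloor>real (Suc k) * T \<omega>\<rfloor> + 1) / real (Suc k)" for k \<omega>
  show ?thesis
  proof (rule borel_measurable_LIMSEQ_real)
    fix \<omega> assume \<omega>: "\<omega> \<in> space N"
    have gt: "T \<omega> < T' k \<omega>" for k
      unfolding T'_def by (simp add: field_simps) linarith
    have le: "T' k \<omega> \<le> T \<omega> + 1 / real (Suc k)" for k
    proof -
      have "T' k \<omega> \<le> (real (Suc k) * T \<omega> + 1) / real (Suc k)"
        unfolding T'_def by (intro divide_right_mono) auto
      also have "\<dots> = T \<omega> + 1 / real (Suc k)" by (simp add: add_divide_distrib del: of_nat_Suc)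
      finally show ?thesis .
    qed
    have "(\<lambda>k. T' k \<omega>) \<longlonglongrightarrow> T \<omega>"
    proof (rule tendsto_sandwich[of "\<lambda>_. T \<omega>" _ _ "\<lambda>k. T \<omega> + 1 / real (Suc k)"])
      show "(\<lambda>k. T \<omega> + 1 / real (Suc k)) \<longlonglongrightarrow> T \<omega>"
        using tendsto_add[OF tendsto_const LIMSEQ_inverse_real_of_nat, of "T \<omega>"]
        by (simp add: inverse_eq_divide)
    qed (use le less_imp_le[OF gt] in auto)
    then have "filterlim (\<lambda>k. T' k \<omega>) (at_right (T \<omega>)) sequentially"
      using gt less_imp_neq[OF gt, symmetric] by (auto simp: filterlim_at intro!: always_eventually)
    moreover have "((\<lambda>s. X s \<omega>) \<longlongrightarrow> X (T \<omega>) \<omega>) (at_right (T \<omega>))"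
      using cont[OF \<omega> T0[OF \<omega>]] by (simp add: continuous_within)
    ultimately show "(\<lambda>k. X (T' k \<omega>) \<omega>) \<longlonglongrightarrow> X (T \<omega>) \<omega>"
      by (rule filterlim_compose[rotated])
  next
    fix k
    \<comment> \<open>All integers \<open>j\<close> occur here, but \<open>X u\<close> is known to
      be measurable only for nonnegative \<open>u\<close>; \<open>max 0\<close> repairs this and
      changes nothing at indices that \<open>T\<close> can produce.\<close>
    have "(\<lambda>\<omega>. (\<lambda>j \<omega>. X (max 0 ((real_of_int j + 1) / real (Suc k))) \<omega>) \<lfloor>real (Suc k) * T \<omega>\<rfloor> \<omega>) \<in> borel_measurable N"
    proof (rule measurable_compose_countable[where f="\<lambda>j \<omega>. X (max 0 ((real_of_int j + 1) / real (Suc k))) \<omega>"])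
      show "X (max 0 ((real_of_int j + 1) / real (Suc k))) \<in> borel_measurable N" for j
        by (rule X) simp
      show "(\<lambda>\<omega>. \<lfloor>real (Suc k) * T \<omega>\<rfloor>) \<in> measurable N (count_space UNIV)"
        using T by measurable
    qed
    moreover have "X (T' k \<omega>) \<omega> = X (max 0 ((real_of_int \<lfloor>real (Suc k) * T \<omega>\<rfloor> + 1) / real (Suc k))) \<omega>"
      if "\<omega> \<in> space N" for \<omega>
    proof -
      have "0 \<le> real_of_int \<lfloor>real (Suc k) * T \<omega>\<rfloor>" using T0[OF that] by simp
      then have "0 \<le> (real_of_int \<lfloor>real (Suc k) * T \<omega>\<rfloor> + 1) / real (Suc k)" by (intro divide_nonneg_pos) auto
      then show ?thesis by (simp add: T'_def max_def del: of_nat_Suc)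
    qed
    ultimately show "(\<lambda>\<omega>. X (T' k \<omega>) \<omega>) \<in> borel_measurable N"
      by (subst measurable_cong) auto
  qed
qed

text \<open>The substitution \<open>y = exp (- x)\<close> turns this into the moment problem on \<open>[0, 1]\<close>, settled by Weierstrass.\<close>

lemma laplace_transform_unique:
  fixes N1 N2 :: "real measure"
  assumes fin: "finite_measure N1" "finite_measure N2"
    and s: "sets N1 = sets borel" "sets N2 = sets borel"
    and nonneg: "AE x in N1. 0 \<le> x" "AE x in N2. 0 \<le> x"
    and eq: "\<And>n::nat. (\<integral>x. exp (- real n * x) \<partial>N1) = (\<integral>x. exp (- real n * x) \<partial>N2)"
  shows "N1 = N2"
proof -
  have [measurable_cong]: "sets N1 = sets borel" "sets N2 = sets borel" using s by auto
  \<comment> \<open>Approximation on the unit interval suffices, because \<open>x\<close> is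
    nonnegative almost everywhere and then \<open>exp (-x)\<close> lies there.\<close>
  have approx: "\<bar>(\<integral>x. \<phi> (exp (-x)) \<partial>N) - (\<integral>x. (\<Sum>i\<le>n. a i * exp (-x) ^ i) \<partial>N)\<bar> \<le> e * measure N (space N)"
    and poly: "(\<integral>x. (\<Sum>i\<le>n. a i * exp (-x) ^ i) \<partial>N) = (\<Sum>i\<le>n. a i * (\<integral>x. exp (- real i * x) \<partial>N))"
    if N: "finite_measure N" "sets N = sets borel" "AE x in N. 0 \<le> x"
      and \<phi>: "\<phi> \<in> borel_measurable borel" "\<And>y. \<bar>\<phi> y\<bar> \<le> 1"
      and le: "\<And>y. y \<in> {0..1} \<Longrightarrow> \<bar>\<phi> y - (\<Sum>i\<le>n. a i * y ^ i)\<bar> < e"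
    for N :: "real measure" and \<phi> :: "real \<Rightarrow> real" and n :: nat and a e
  proof -
    interpret finite_measure N by fact
    have [measurable_cong]: "sets N = sets borel" using N by auto
    note [measurable] = \<phi>(1)
    have pow: "exp (-x) ^ i = exp (- real i * x)" for x :: real and i :: nat
      by (simp add: exp_of_nat_mult[symmetric])
    have i1: "integrable N (\<lambda>x. exp (- real i * x))" for i :: nat
      by (rule integrable_const_bound[where B=1]) (use N(3) in \<open>auto elim!: eventually_mono\<close>)
    have i2: "integrable N (\<lambda>x. \<phi> (exp (-x)))"
      by (rule integrable_const_bound[where B=1]) (use \<phi> in auto)
    have i3: "integrable N (\<lambda>x. (\<Sum>i\<le>n. a i * exp (-x) ^ i))"
      unfolding pow using i1 by auto
    show "(\<integral>x. (\<Sum>i\<le>n. a i * exp (-x) ^ i) \<partial>N) = (\<Sum>i\<le>n. a i * (\<integral>x. exp (- real i * x) \<partial>N))"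
      unfolding pow using i1 by (subst Bochner_Integration.integral_sum) auto
    have "\<bar>(\<integral>x. \<phi> (exp (-x)) \<partial>N) - (\<integral>x. (\<Sum>i\<le>n. a i * exp (-x) ^ i) \<partial>N)\<bar>
        = \<bar>\<integral>x. \<phi> (exp (-x)) - (\<Sum>i\<le>n. a i * exp (-x) ^ i) \<partial>N\<bar>"
      using i2 i3 by simp
    also have "\<dots> \<le> (\<integral>x. \<bar>\<phi> (exp (-x)) - (\<Sum>i\<le>n. a i * exp (-x) ^ i)\<bar> \<partial>N)"
      by (rule integral_abs_bound)
    also have "\<dots> \<le> (\<integral>x. e \<partial>N)"
      by (rule integral_mono_AE) (use i2 i3 N(3) le in \<open>auto elim!: eventually_mono intro!: less_imp_le\<close>)
    finally show "\<bar>(\<integral>x. \<phi> (exp (-x)) \<partial>N) - (\<integral>x. (\<Sum>i\<le>n. a i * exp (-x) ^ i) \<partial>N)\<bar> \<le> e * measure N (space N)"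
      by (simp add: mult.commute)
  qed
  have cont_eq: "(\<integral>x. \<phi> (exp (-x)) \<partial>N1) = (\<integral>x. \<phi> (exp (-x)) \<partial>N2)"
    if \<phi>: "continuous_on UNIV \<phi>" "\<And>y. \<bar>\<phi> y\<bar> \<le> 1" for \<phi> :: "real \<Rightarrow> real"
  proof (rule ccontr)
    have m: "\<phi> \<in> borel_measurable borel" using \<phi>(1) by (rule borel_measurable_continuous_onI)
    let ?d = "\<bar>(\<integral>x. \<phi> (exp (-x)) \<partial>N1) - (\<integral>x. \<phi> (exp (-x)) \<partial>N2)\<bar>"
    \<comment> \<open>The two approximation errors add up to at most \<open>e * K\<close>, which is
      half the assumed gap for the \<open>e\<close> chosen below. The summand 1 keeps
      \<open>K\<close> positive even for null measures.\<close>
    define K where "K = measure N1 (space N1) + measure N2 (space N2) + 1"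
    assume "(\<integral>x. \<phi> (exp (-x)) \<partial>N1) \<noteq> (\<integral>x. \<phi> (exp (-x)) \<partial>N2)"
    then have d: "0 < ?d" by simp
    have K: "1 \<le> K" by (simp add: K_def)
    define e where "e = ?d / (2 * K)"
    have e: "0 < e" unfolding e_def using d K by (intro divide_pos_pos) auto
    obtain g where g: "real_polynomial_function g" "\<And>y. y \<in> {0..1::real} \<Longrightarrow> \<bar>\<phi> y - g y\<bar> < e"
      using Stone_Weierstrass_real_polynomial_function[of "{0..1::real}" \<phi> e] e continuous_on_subset[OF \<phi>(1)]
      by auto
    then obtain a n where an: "\<And>y. y \<in> {0..1} \<Longrightarrow> \<bar>\<phi> y - (\<Sum>i\<le>n. a i * y ^ i)\<bar> < e"
      unfolding real_polynomial_function_iff_sum by auto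
    have "?d \<le> e * measure N1 (space N1) + e * measure N2 (space N2)"
      using approx[OF fin(1) s(1) nonneg(1) m \<phi>(2) an] approx[OF fin(2) s(2) nonneg(2) m \<phi>(2) an]
        poly[OF fin(1) s(1) nonneg(1) m \<phi>(2) an] poly[OF fin(2) s(2) nonneg(2) m \<phi>(2) an]
      unfolding eq by linarith
    also have "\<dots> \<le> e * K" using e by (simp add: K_def algebra_simps)
    also have "\<dots> = ?d / 2" unfolding e_def using K by (simp add: field_simps)
    finally show False using d by simp
  qed
  \<comment> \<open>Continuous ramps with values in the unit interval that increase to the indicator
    of \<open>y < c\<close>. With \<open>exp (-c)\<close> for \<open>c\<close> and
    \<open>exp (-x)\<close> for \<open>y\<close>, the limit is the indicator of
    \<open>c < x\<close>.\<close>
  define \<phi> where "\<phi> c k y = min 1 (real k * max 0 (c - y))" for c :: real and k :: nat and y :: real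
  have lim: "(\<lambda>k. \<integral>x. \<phi> (exp (-c)) k (exp (-x)) \<partial>N) \<longlonglongrightarrow> measure N {c<..}"
    if N: "finite_measure N" "sets N = sets borel" for N :: "real measure" and c
  proof -
    interpret finite_measure N by fact
    have [measurable_cong]: "sets N = sets borel" using N by auto
    have "(\<lambda>k. \<integral>x. \<phi> (exp (-c)) k (exp (-x)) \<partial>N) \<longlonglongrightarrow> (\<integral>x. indicat_real {c<..} x \<partial>N)"
    proof (rule integral_dominated_convergence[where w="\<lambda>_. 1"])
      show "AE x in N. (\<lambda>k. \<phi> (exp (- c)) k (exp (- x))) \<longlonglongrightarrow> indicat_real {c<..} x"
      proof (rule AE_I2)
        fix x
        show "(\<lambda>k. \<phi> (exp (- c)) k (exp (- x))) \<longlonglongrightarrow> indicat_real {c<..} x"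
        proof (cases "c < x")
          case True
          define d where "d = exp (-c) - exp (-x)"
          have d: "0 < d" using True by (simp add: d_def)
          obtain k0 :: nat where k0: "1 < real k0 * d" using ex_less_of_nat_mult[OF d, of 1] by auto
          have "\<phi> (exp (- c)) k (exp (- x)) = 1" if "k \<ge> k0" for k
          proof -
            have "1 \<le> real k * d" using k0 that d by (smt (verit) mult_right_mono of_nat_le_iff)
            then show ?thesis using d by (simp add: \<phi>_def d_def)
          qed
          then have "\<forall>\<^sub>F k in sequentially. \<phi> (exp (- c)) k (exp (- x)) = 1"
            unfolding eventually_sequentially by blast
          then show ?thesis using True by (simp add: tendsto_eventually)
        qed (simp add: \<phi>_def)
      qed
    qed (auto simp: \<phi>_def abs_le_iff)
    then show ?thesis using N(2) by (simp add: sets_eq_imp_space_eq)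
  qed
  have "measure N1 {c<..} = measure N2 {c<..}" for c
  proof -
    have "(\<integral>x. \<phi> (exp (-c)) k (exp (-x)) \<partial>N1) = (\<integral>x. \<phi> (exp (-c)) k (exp (-x)) \<partial>N2)" for k
      by (rule cont_eq) (auto simp: \<phi>_def abs_le_iff intro!: continuous_intros)
    then show ?thesis
      using LIMSEQ_unique[OF lim[OF fin(1) s(1), of c]] lim[OF fin(2) s(2), of c] by simp
  qed
  then show ?thesis
    by (intro measure_eqI_lessThan s)
       (auto simp: finite_measure.emeasure_eq_measure[OF fin(1)] finite_measure.emeasure_eq_measure[OF fin(2)])
qed

section \<open>Weighted laws, and integrals under independence\<close>

context prob_space
begin

text \<open>Uniqueness applied to the laws of \<open>X\<close> and \<open>X'\<close> under the
  densities \<open>w\<close> and \<open>w'\<close>. An exponential weight will yield the tilting of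
  an increment; an indicator weight compared with a constant one will yield an independence.\<close>

lemma weighted_laplace_transform_unique:
  fixes X X' w w' :: "'a \<Rightarrow> real"
  assumes [measurable]: "X \<in> borel_measurable M" "X' \<in> borel_measurable M"
    and X0: "\<And>\<omega>. \<omega> \<in> space M \<Longrightarrow> 0 \<le> X \<omega>" "\<And>\<omega>. \<omega> \<in> space M \<Longrightarrow> 0 \<le> X' \<omega>"
    and w: "integrable M w" "integrable M w'" "\<And>\<omega>. 0 \<le> w \<omega>" "\<And>\<omega>. 0 \<le> w' \<omega>"
    and eq: "\<And>n::nat. (\<integral>\<omega>. w \<omega> * exp (- real n * X \<omega>) \<partial>M) = (\<integral>\<omega>. w' \<omega> * exp (- real n * X' \<omega>) \<partial>M)"
    and [measurable]: "A \<in> sets borel"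
  shows "(\<integral>\<omega>. w \<omega> * indicator A (X \<omega>) \<partial>M) = (\<integral>\<omega>. w' \<omega> * indicator A (X' \<omega>) \<partial>M)"
proof -
  have int_eq: "(\<integral>x. g x \<partial>distr (density M v) borel Z) = (\<integral>\<omega>. v \<omega> * g (Z \<omega>) \<partial>M)"
    if [measurable]: "Z \<in> borel_measurable M" "g \<in> borel_measurable borel" and v: "integrable M v" "\<And>\<omega>. 0 \<le> v \<omega>"
    for Z v :: "'a \<Rightarrow> real" and g :: "real \<Rightarrow> real"
  proof -
    have [measurable]: "v \<in> borel_measurable M" using v by auto
    have "(\<integral>x. g x \<partial>distr (density M v) borel Z) = (\<integral>\<omega>. g (Z \<omega>) \<partial>density M v)"
      by (rule integral_distr) auto
    also have "\<dots> = (\<integral>\<omega>. v \<omega> * g (Z \<omega>) \<partial>M)"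
      by (subst integral_density) (use v in auto)
    finally show ?thesis .
  qed
  have fin: "finite_measure (distr (density M v) borel Z)" "AE x in distr (density M v) borel Z. 0 \<le> x"
    if [measurable]: "Z \<in> borel_measurable M" and v: "integrable M v" "\<And>\<omega>. 0 \<le> v \<omega>"
      and Z0: "\<And>\<omega>. \<omega> \<in> space M \<Longrightarrow> 0 \<le> Z \<omega>"
    for Z v :: "'a \<Rightarrow> real"
  proof -
    have [measurable]: "v \<in> borel_measurable M" using v by auto
    have "emeasure (density M v) (space M) = ennreal (\<integral>\<omega>. v \<omega> \<partial>M)"
      by (subst emeasure_density) (use v in \<open>auto simp: nn_integral_eq_integral mult_indicator_subset cong: nn_integral_cong\<close>)
    then have "finite_measure (density M v)" by (intro finite_measureI) auto
    then show "finite_measure (distr (density M v) borel Z)"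
      by (rule finite_measure.finite_measure_distr) auto
    show "AE x in distr (density M v) borel Z. 0 \<le> x"
      by (subst AE_distr_iff) (auto simp: AE_density Z0)
  qed
  have "distr (density M w) borel X = distr (density M w') borel X'"
    by (rule laplace_transform_unique) (use w X0 eq in \<open>auto intro!: fin simp: int_eq\<close>)
  then show ?thesis
    using int_eq[of X "indicator A" w] int_eq[of X' "indicator A" w'] w by simp
qed

lemma integral_indicator_indep_set:
  fixes W :: "'a \<Rightarrow> real"
  assumes Y: "subalgebra M Y" and B: "subalgebra M B" and ind: "indep_set (sets Y) (sets B)"
    and A: "A \<in> sets Y" and W: "W \<in> borel_measurable B" "integrable M W"
  shows "(\<integral>\<omega>. indicator A \<omega> * W \<omega> \<partial>M) = prob A * (\<integral>\<omega>. W \<omega> \<partial>M)"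
proof -
  have sp: "space Y = space M" "space B = space M" and sub: "sets Y \<subseteq> events" "sets B \<subseteq> events"
    using Y B by (auto simp: subalgebra_def)
  have A': "A \<in> events" using A sub by auto
  have mA: "indicat_real A \<in> borel_measurable Y" using A by auto
  have le: "sigma_sets (space M) {Z -` D \<inter> space M | D. D \<in> sets borel} \<subseteq> sets N"
    if "Z \<in> borel_measurable N" "space N = space M" for Z :: "'a \<Rightarrow> real" and N
    unfolding that(2)[symmetric] by (rule sets.sigma_sets_subset) (auto intro!: measurable_sets[OF that(1)])
  have "indep_var borel (indicat_real A) borel W"
    unfolding indep_var_eq
  proof (intro conjI indep_setI)
    show "random_variable borel (indicat_real A)" using A' by auto
    show "random_variable borel W" using W by auto
  qed (use le[OF mA sp(1)] le[OF W(1) sp(2)] sub in \<open>auto intro!: indep_setD[OF ind]\<close>)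
  then have "(\<integral>\<omega>. indicator A \<omega> * W \<omega> \<partial>M) = (\<integral>\<omega>. indicator A \<omega> \<partial>M) * (\<integral>\<omega>. W \<omega> \<partial>M)"
    by (rule indep_var_lebesgue_integral) (use A' W in \<open>auto simp: less_top[symmetric]\<close>)
  then show ?thesis using A' by simp
qed

text \<open>Adding independent information does not change a conditional expectation: if that of
  \<open>W\<close> given \<open>G\<close> vanishes, so does that given \<open>G\<close> and
  \<open>Y\<close> jointly. On \<open>a \<inter> b\<close> the variable
  \<open>indicator b \<omega> * W \<omega>\<close> is still \<open>B\<close>-measurable, so
  \<open>prob a\<close> splits off and leaves an integral over an event of \<open>G\<close>. These
  intersections form a pi-system, and a Dynkin induction does the rest.\<close>

lemma set_integral_zero_indep_enlarge:
  fixes W :: "'a \<Rightarrow> real"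
  assumes Y: "subalgebra M Y" and B: "subalgebra M B" and ind: "indep_set (sets Y) (sets B)"
    and G: "subalgebra B G" and W: "W \<in> borel_measurable B" "integrable M W"
    and zero: "\<And>D. D \<in> sets G \<Longrightarrow> (\<integral>\<omega>\<in>D. W \<omega> \<partial>M) = 0"
    and A: "A \<in> sigma_sets (space M) {a \<inter> b | a b. a \<in> sets Y \<and> b \<in> sets G}"
  shows "(\<integral>\<omega>\<in>A. W \<omega> \<partial>M) = 0"
proof -
  let ?E = "{a \<inter> b | a b. a \<in> sets Y \<and> b \<in> sets G}"
  have sp: "space Y = space M" "space B = space M" "space G = space M"
    and sub: "sets Y \<subseteq> events" "sets B \<subseteq> events" "sets G \<subseteq> sets B"
    using Y B G by (auto simp: subalgebra_def)
  have E: "?E \<subseteq> events" using sub by auto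
  then have ev: "sigma_sets (space M) ?E \<subseteq> events" by (rule sets.sigma_sets_subset)
  have si: "set_integrable M D W" if "D \<in> events" for D
    unfolding set_integrable_def using that W(2) by (intro integrable_mult_indicator) auto
  have st: "Int_stable ?E"
  proof (rule Int_stableI)
    fix x y assume "x \<in> ?E" "y \<in> ?E"
    then obtain a b a' b' where "x = a \<inter> b" "y = a' \<inter> b'" "a \<in> sets Y" "a' \<in> sets Y" "b \<in> sets G" "b' \<in> sets G"
      by auto
    then have "x \<inter> y = (a \<inter> a') \<inter> (b \<inter> b')" "a \<inter> a' \<in> sets Y" "b \<inter> b' \<in> sets G" by auto
    then show "x \<inter> y \<in> ?E" by blast
  qed
  have "?E \<subseteq> Pow (space M)" using E sets.sets_into_space by auto
  from st this A show ?thesis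
  proof (induction rule: sigma_sets_induct_disjoint)
    case (basic A)
    then obtain a b where ab: "A = a \<inter> b" "a \<in> sets Y" "b \<in> sets G" by auto
    have b: "b \<in> sets B" using ab sub by auto
    have "(\<integral>\<omega>\<in>A. W \<omega> \<partial>M) = (\<integral>\<omega>. indicator a \<omega> * (indicator b \<omega> * W \<omega>) \<partial>M)"
      unfolding ab set_lebesgue_integral_def by (simp add: indicator_inter_arith mult.assoc)
    also have "\<dots> = prob a * (\<integral>\<omega>. indicator b \<omega> * W \<omega> \<partial>M)"
    proof (rule integral_indicator_indep_set[OF Y B ind ab(2)])
      show "(\<lambda>\<omega>. indicator b \<omega> * W \<omega>) \<in> borel_measurable B" using b W(1) by measurable
      show "integrable M (\<lambda>\<omega>. indicator b \<omega> * W \<omega>)"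
        using si[of b] b sub by (auto simp: set_integrable_def)
    qed
    also have "\<dots> = 0" using zero[OF ab(3)] by (simp add: set_lebesgue_integral_def)
    finally show ?case .
  next
    case empty
    then show ?case by (simp add: set_lebesgue_integral_def)
  next
    case (compl A)
    have "A \<in> events" using compl ev by auto
    have "(\<integral>\<omega>\<in>space M. W \<omega> \<partial>M) = 0" using zero[OF sets.top] sp by simp
    moreover have "(\<integral>\<omega>\<in>(space M - A) \<union> A. W \<omega> \<partial>M) = (\<integral>\<omega>\<in>space M - A. W \<omega> \<partial>M) + (\<integral>\<omega>\<in>A. W \<omega> \<partial>M)"
      by (rule set_integral_Un) (use \<open>A \<in> events\<close> in \<open>auto intro!: si\<close>)
    moreover have "(space M - A) \<union> A = space M" using \<open>A \<in> events\<close> sets.sets_into_space by blast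
    ultimately show ?case using compl by simp
  next
    case (union A)
    have A: "\<And>i. A i \<in> events" using union ev by auto
    have "(\<integral>\<omega>\<in>(\<Union>i. A i). W \<omega> \<partial>M) = (\<Sum>i. (\<integral>\<omega>\<in>A i. W \<omega> \<partial>M))"
      by (rule lebesgue_integral_countable_add) (use union A in \<open>auto intro!: si simp: disjoint_family_on_def\<close>)
    then show ?case using union by simp
  qed
qed

end

section \<open>The gamma process\<close>

lemma finite_mesh:
  assumes "finite K" "K \<subseteq> {0::real..}" "0 \<in> K"
  obtains ts :: "nat \<Rightarrow> real" and N where "ts 0 = 0" "\<forall>i j. i \<le> j \<longrightarrow> j \<le> N \<longrightarrow> ts i \<le> ts j" "ts ` {..N} = K"
proof
  let ?L = "sorted_list_of_set K"
  have L: "set ?L = K" "sorted ?L" "?L \<noteq> []" using assms by auto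
  have len: "length ?L - 1 < length ?L"
    using L(3) by (metis diff_less length_greater_0_conv zero_less_one)
  have mono: "?L ! i \<le> ?L ! j" if "i \<le> j" "j \<le> length ?L - 1" for i j
    using that len L by (intro sorted_nth_mono) auto
  then show "\<forall>i j. i \<le> j \<longrightarrow> j \<le> length ?L - 1 \<longrightarrow> ?L ! i \<le> ?L ! j" by blast
  have "{..length ?L - 1} = {..<length ?L}" using len by auto
  then show img: "(!) ?L ` {..length ?L - 1} = K"
    using L(1) by (auto simp: set_conv_nth)
  have "0 \<in> (!) ?L ` {..length ?L - 1}" unfolding img by fact
  then obtain i where "0 = ?L ! i" "i \<in> {..length ?L - 1}" by (rule imageE)
  then have "?L ! 0 \<le> 0" using mono[of 0 i] by simp
  moreover have "?L ! 0 \<in> K" using img by auto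
  ultimately show "?L ! 0 = 0" using assms(2) by force
qed

text \<open>With \<open>t\<close> itself a mesh point, values up to \<open>t\<close> and increments
  after \<open>t\<close> become sums over the two disjoint blocks of mesh increments, before and
  after position \<open>n\<close>.\<close>

lemma finite_mesh_through:
  assumes "finite K" "K \<subseteq> {0..}" "0 \<le> t"
  obtains ts :: "nat \<Rightarrow> real" and n N idx where
    "ts 0 = 0" "\<forall>i<N. ts i \<le> ts (Suc i)" "n \<le> N" "ts n = t"
    "\<forall>s\<in>K. s \<le> t \<longrightarrow> idx s \<le> n \<and> ts (idx s) = s"
    "\<forall>s\<in>K. t < s \<longrightarrow> n \<le> idx s \<and> idx s \<le> N \<and> ts (idx s) = s"
proof -
  have "finite (insert 0 (insert t K))" "insert 0 (insert t K) \<subseteq> {0..}" "0 \<in> insert 0 (insert t K)"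
    using assms by auto
  then obtain ts :: "nat \<Rightarrow> real" and N where ts: "ts 0 = 0"
    "\<forall>i j. i \<le> j \<longrightarrow> j \<le> N \<longrightarrow> ts i \<le> ts j" "ts ` {..N} = insert 0 (insert t K)"
    by (rule finite_mesh) (rule that)
  have "t \<in> ts ` {..N}" using ts(3) by auto
  then obtain n where n: "n \<le> N" "ts n = t" by auto
  have "\<exists>i. (s \<le> t \<longrightarrow> i \<le> n) \<and> (t < s \<longrightarrow> n \<le> i) \<and> i \<le> N \<and> ts i = s" if s: "s \<in> K" for s
  proof -
    have "s \<in> ts ` {..N}" using ts(3) s by auto
    then obtain i where i: "i \<le> N" "ts i = s" by auto
    show ?thesis
    proof (cases "s \<le> t")
      case True
      show ?thesis
      proof (cases "i \<le> n")
        \<comment> \<open>The mesh is only known to be nondecreasing, so a value may repeat. An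
          index beyond \<open>n\<close> for some \<open>s \<le> t\<close> forces
          \<open>s = t\<close>, and then \<open>n\<close> serves instead.\<close>
        case False
        then have "ts n \<le> s" using ts(2)[rule_format, of n i] i by auto
        then show ?thesis using True n by (intro exI[of _ n]) auto
      qed (use i True in auto)
    next
      case False
      then have "n \<le> i" using ts(2)[rule_format, of i n] i n by (metis nle_le)
      then show ?thesis using i False by auto
    qed
  qed
  then obtain idx where idx: "\<And>s. s \<in> K \<Longrightarrow> (s \<le> t \<longrightarrow> idx s \<le> n) \<and> (t < s \<longrightarrow> n \<le> idx s) \<and> idx s \<le> N \<and> ts (idx s) = s"
    by metis
  show thesis
    by (rule that[of ts N n idx]) (use ts n idx in auto)
qed

section \<open>Paths and increments of the gamma process\<close>

locale gamma_process = prob_space M for M :: "'a measure" +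
  fixes \<gamma> :: "real \<Rightarrow> 'a \<Rightarrow> real"
  assumes std: "std_gamma_process M \<gamma>"
begin

lemma meas [measurable]: "0 \<le> t \<Longrightarrow> \<gamma> t \<in> borel_measurable M"
  using std by (simp add: std_gamma_process_def)

lemma start: "\<omega> \<in> space M \<Longrightarrow> \<gamma> 0 \<omega> = 0"
  using std by (simp add: std_gamma_process_def)

lemma nondecreasing: "\<omega> \<in> space M \<Longrightarrow> 0 \<le> s \<Longrightarrow> s \<le> u \<Longrightarrow> \<gamma> s \<omega> \<le> \<gamma> u \<omega>"
  using std unfolding std_gamma_process_def mono_on_def by auto

lemma nonneg: "\<omega> \<in> space M \<Longrightarrow> 0 \<le> s \<Longrightarrow> 0 \<le> \<gamma> s \<omega>"
  using nondecreasing[of \<omega> 0 s] start by simp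

lemma right_continuous: "\<omega> \<in> space M \<Longrightarrow> 0 \<le> s \<Longrightarrow> continuous (at_right s) (\<lambda>u. \<gamma> u \<omega>)"
proof -
  have "\<forall>\<omega>\<in>space M. \<forall>t\<ge>0. continuous (at_right t) (\<lambda>s. \<gamma> s \<omega>) \<and>
      (t > 0 \<longrightarrow> (\<exists>l. ((\<lambda>s. \<gamma> s \<omega>) \<longlongrightarrow> l) (at_left t)))"
    using std unfolding std_gamma_process_def by (elim conjE)
  then show "\<omega> \<in> space M \<Longrightarrow> 0 \<le> s \<Longrightarrow> continuous (at_right s) (\<lambda>u. \<gamma> u \<omega>)" by simp
qed

lemma indep_increments:
  fixes n :: nat and ts :: "nat \<Rightarrow> real"
  assumes "0 \<le> ts 0" "\<And>i. i < n \<Longrightarrow> ts i \<le> ts (Suc i)"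
  shows "indep_vars (\<lambda>_. borel) (\<lambda>i \<omega>. \<gamma> (ts (Suc i)) \<omega> - \<gamma> (ts i) \<omega>) {..<n}"
proof -
  have "\<forall>(n::nat) (ts::nat \<Rightarrow> real). 0 \<le> ts 0 \<and> (\<forall>i<n. ts i \<le> ts (Suc i)) \<longrightarrow>
      indep_vars (\<lambda>_. borel) (\<lambda>i \<omega>. \<gamma> (ts (Suc i)) \<omega> - \<gamma> (ts i) \<omega>) {..<n}"
    using std unfolding std_gamma_process_def by (elim conjE)
  then show ?thesis using assms by simp
qed

lemma laplace:
  assumes "0 \<le> u" "0 \<le> l"
  shows "expectation (\<lambda>\<omega>. exp (- l * \<gamma> u \<omega>)) = (1 + l) powr (- u)"
proof -
  have "\<forall>l t. 0 \<le> l \<longrightarrow> 0 \<le> t \<longrightarrow> expectation (\<lambda>\<omega>. exp (- l * \<gamma> t \<omega>)) = (1 + l) powr (- t)"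
    using std unfolding std_gamma_process_def by (elim conjE)
  then show ?thesis using assms by simp
qed

lemma increment_laplace:
  assumes "0 \<le> s" "s \<le> u" "0 \<le> l"
  shows "expectation (\<lambda>\<omega>. exp (- l * (\<gamma> u \<omega> - \<gamma> s \<omega>))) = (1 + l) powr (- (u - s))"
proof -
  have "\<forall>s h. 0 \<le> s \<longrightarrow> 0 \<le> h \<longrightarrow>
      distr M borel (\<lambda>\<omega>. \<gamma> (s + h) \<omega> - \<gamma> s \<omega>) = distr M borel (\<gamma> h)"
    using std unfolding std_gamma_process_def by (elim conjE)
  from this[rule_format, of s "u - s"]
  have eq: "distr M borel (\<lambda>\<omega>. \<gamma> u \<omega> - \<gamma> s \<omega>) = distr M borel (\<gamma> (u - s))" using assms by simp
  have "expectation (\<lambda>\<omega>. exp (- l * (\<gamma> u \<omega> - \<gamma> s \<omega>)))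
      = (\<integral>x. exp (- l * x) \<partial>distr M borel (\<lambda>\<omega>. \<gamma> u \<omega> - \<gamma> s \<omega>))"
    using assms by (subst integral_distr) auto
  also have "\<dots> = expectation (\<lambda>\<omega>. exp (- l * \<gamma> (u - s) \<omega>))"
    unfolding eq using assms by (subst integral_distr) auto
  also have "\<dots> = (1 + l) powr (- (u - s))"
    using assms by (intro laplace) auto
  finally show ?thesis .
qed

lemma integrable_exp_increment:
  assumes "0 \<le> s" "s \<le> u" "0 \<le> l"
  shows "integrable M (\<lambda>\<omega>. exp (- l * (\<gamma> u \<omega> - \<gamma> s \<omega>)))"
  by (rule integrable_const_bound[where B=1])
     (use assms nondecreasing[of _ s u] in auto)

text \<open>Where the increment vanishes, \<open>exp (- n * 0) = 1\<close> for every
  \<open>n\<close>. So that event has probability at most \<open>(1 + n) powr (- (u - s))\<close>,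
  which tends to 0.\<close>

lemma AE_strictly_increasing:
  assumes "0 \<le> s" "s < u"
  shows "AE \<omega> in M. \<gamma> s \<omega> < \<gamma> u \<omega>"
proof -
  let ?S = "{\<omega> \<in> space M. \<gamma> u \<omega> - \<gamma> s \<omega> = 0}"
  have [measurable]: "\<gamma> s \<in> borel_measurable M" "\<gamma> u \<in> borel_measurable M" using assms by auto
  have S: "?S \<in> events" by measurable
  have le: "prob ?S \<le> (1 + real n) powr (- (u - s))" for n
  proof -
    have "prob ?S = expectation (indicat_real ?S)" using S by simp
    also have "\<dots> \<le> expectation (\<lambda>\<omega>. exp (- real n * (\<gamma> u \<omega> - \<gamma> s \<omega>)))"
      by (rule integral_mono)
         (use assms S integrable_exp_increment[of s u "real n"] in \<open>auto simp: less_top[symmetric] split: split_indicator\<close>)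
    also have "\<dots> = (1 + real n) powr (- (u - s))" using assms by (intro increment_laplace) auto
    finally show ?thesis .
  qed
  have "filterlim (\<lambda>n. 1 + real n) at_top sequentially"
    by (rule filterlim_tendsto_add_at_top[OF tendsto_const filterlim_real_sequentially])
  then have "(\<lambda>n. (1 + real n) powr (- (u - s))) \<longlonglongrightarrow> 0"
    using assms by (intro tendsto_neg_powr) auto
  then have "prob ?S \<le> 0" by (rule LIMSEQ_le_const) (use le in auto)
  then have "prob ?S = 0" using measure_nonneg[of M ?S] by linarith
  then have "emeasure M ?S = 0" by (simp add: emeasure_eq_measure)
  then have "AE \<omega> in M. \<not> (\<gamma> u \<omega> - \<gamma> s \<omega> = 0)"
    by (intro AE_I[of _ _ ?S]) (use S in auto)
  then show ?thesis
    using AE_space by eventually_elim (use nondecreasing[of _ s u] assms in force)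
qed

section \<open>Exponential tilting\<close>

lemma increment_tilt:
  assumes s: "0 \<le> s" "s \<le> u" "0 \<le> l" and A: "A \<in> sets borel"
  shows "expectation (\<lambda>\<omega>. exp (- l * (\<gamma> u \<omega> - \<gamma> s \<omega>)) * indicator A (\<gamma> u \<omega> - \<gamma> s \<omega>))
    = (1 + l) powr (- (u - s)) * expectation (\<lambda>\<omega>. indicator A ((\<gamma> u \<omega> - \<gamma> s \<omega>) / (1 + l)))"
proof -
  have [measurable]: "\<gamma> s \<in> borel_measurable M" "\<gamma> u \<in> borel_measurable M" using assms by auto
  let ?c = "(1 + l) powr (- (u - s))"
  have "expectation (\<lambda>\<omega>. exp (- l * (\<gamma> u \<omega> - \<gamma> s \<omega>)) * indicator A (\<gamma> u \<omega> - \<gamma> s \<omega>))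
      = expectation (\<lambda>\<omega>. ?c * indicator A ((\<gamma> u \<omega> - \<gamma> s \<omega>) / (1 + l)))"
  proof (rule weighted_laplace_transform_unique)
    fix n :: nat
    have "expectation (\<lambda>\<omega>. exp (- l * (\<gamma> u \<omega> - \<gamma> s \<omega>)) * exp (- real n * (\<gamma> u \<omega> - \<gamma> s \<omega>)))
        = expectation (\<lambda>\<omega>. exp (- (l + real n) * (\<gamma> u \<omega> - \<gamma> s \<omega>)))"
      by (simp add: exp_add[symmetric] algebra_simps)
    also have "\<dots> = (1 + (l + real n)) powr (- (u - s))" using s by (intro increment_laplace) auto
    \<comment> \<open>This factorisation is the special feature of the gamma law: the tilted
      transform at \<open>n\<close> is a constant times the original one at
      \<open>n / (1 + l)\<close>, hence belongs to the increment divided by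
      \<open>1 + l\<close>.\<close>
    also have "1 + (l + real n) = (1 + l) * (1 + real n / (1 + l))" using s by (simp add: field_simps)
    also have "\<dots> powr (- (u - s)) = ?c * (1 + real n / (1 + l)) powr (- (u - s))"
      by (rule powr_mult)
    also have "(1 + real n / (1 + l)) powr (- (u - s)) = expectation (\<lambda>\<omega>. exp (- (real n / (1 + l)) * (\<gamma> u \<omega> - \<gamma> s \<omega>)))"
      using s by (intro increment_laplace[symmetric]) auto
    finally show "expectation (\<lambda>\<omega>. exp (- l * (\<gamma> u \<omega> - \<gamma> s \<omega>)) * exp (- real n * (\<gamma> u \<omega> - \<gamma> s \<omega>)))
        = expectation (\<lambda>\<omega>. ?c * exp (- real n * ((\<gamma> u \<omega> - \<gamma> s \<omega>) / (1 + l))))"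
      by simp
  qed (use s A nondecreasing[of _ s u] integrable_exp_increment[of s u l] in auto)
  then show ?thesis by simp
qed

text \<open>The weight \<open>exp (- l * \<gamma> (ts n) \<omega>)\<close> is a product over the
  increments, so independence tilts each one separately, all with the same divisor. The constants
  multiply to \<open>(1 + l) powr (- ts n)\<close>. Boxes determine a finite measure on the product
  space, which gives every measurable \<open>S\<close>.\<close>

lemma increments_tilt:
  fixes ts :: "nat \<Rightarrow> real" and n :: nat
  defines "inc \<equiv> \<lambda>i \<omega>. \<gamma> (ts (Suc i)) \<omega> - \<gamma> (ts i) \<omega>"
  assumes ts0: "ts 0 = 0" and mono: "\<And>i. i < n \<Longrightarrow> ts i \<le> ts (Suc i)" and l: "0 \<le> l"
    and S: "S \<in> sets (PiM {..<n} (\<lambda>_. borel))"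
  shows "expectation (\<lambda>\<omega>. exp (- l * \<gamma> (ts n) \<omega>) * indicator S (\<lambda>i\<in>{..<n}. inc i \<omega>))
    = (1 + l) powr (- ts n) * expectation (\<lambda>\<omega>. indicator S (\<lambda>i\<in>{..<n}. inc i \<omega> / (1 + l)))"
proof -
  have ge: "0 \<le> ts i" if "i \<le> n" for i
    using that by (induction i) (use ts0 mono in \<open>auto intro: order_trans simp: Suc_le_eq\<close>)
  have inc_meas [measurable]: "inc i \<in> borel_measurable M" if "i < n" for i
    unfolding inc_def using ge[of i] ge[of "Suc i"] that by auto
  have tsn [measurable]: "\<gamma> (ts n) \<in> borel_measurable M" using ge by auto
  have ind: "indep_vars (\<lambda>_. borel) inc {..<n}"
    unfolding inc_def using ts0 mono by (intro indep_increments) auto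
  have sum_inc: "(\<Sum>i<n. inc i \<omega>) = \<gamma> (ts n) \<omega>" if "\<omega> \<in> space M" for \<omega>
    unfolding inc_def using sum_lessThan_telescope[of "\<lambda>i. \<gamma> (ts i) \<omega>" n] start[OF that] ts0 by simp
  have sum_ts: "(\<Sum>i<n. ts (Suc i) - ts i) = ts n"
    using sum_lessThan_telescope[of ts n] ts0 by simp
  let ?P = "PiM {..<n} (\<lambda>_. borel :: real measure)"
  let ?w = "\<lambda>\<omega>. exp (- l * \<gamma> (ts n) \<omega>)"
  let ?c = "(1 + l) powr (- ts n)"
  have c: "0 \<le> ?c" by simp
  have intw: "integrable M ?w"
    using integrable_exp_increment[of 0 "ts n" l] ge[of n] l start
    by (auto cong: Bochner_Integration.integrable_cong)
  have D1 [measurable]: "(\<lambda>\<omega>. \<lambda>i\<in>{..<n}. inc i \<omega>) \<in> measurable M ?P" by (rule measurable_restrict) auto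
  have D2 [measurable]: "(\<lambda>\<omega>. \<lambda>i\<in>{..<n}. inc i \<omega> / (1 + l)) \<in> measurable M ?P"
    by (rule measurable_restrict) auto
  let ?N1 = "distr (density M ?w) ?P (\<lambda>\<omega>. \<lambda>i\<in>{..<n}. inc i \<omega>)"
  let ?N2 = "distr (density M (\<lambda>_. ?c)) ?P (\<lambda>\<omega>. \<lambda>i\<in>{..<n}. inc i \<omega> / (1 + l))"
  have int_eq: "emeasure (distr (density M v) ?P Z) T = ennreal (\<integral>\<omega>. v \<omega> * indicator T (Z \<omega>) \<partial>M)"
    if [measurable]: "Z \<in> measurable M ?P" "T \<in> sets ?P" and v: "integrable M v" "\<And>\<omega>. 0 \<le> v \<omega>"
    for Z v T
  proof -
    have [measurable]: "v \<in> borel_measurable M" using v by auto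
    have "emeasure (distr (density M v) ?P Z) T = emeasure (density M v) (Z -` T \<inter> space M)"
      by (subst emeasure_distr) auto
    also have "\<dots> = (\<integral>\<^sup>+\<omega>. ennreal (v \<omega>) * indicator (Z -` T \<inter> space M) \<omega> \<partial>M)"
      by (rule emeasure_density) auto
    also have "\<dots> = (\<integral>\<^sup>+\<omega>. ennreal (v \<omega> * indicator T (Z \<omega>)) \<partial>M)"
      by (intro nn_integral_cong) (auto split: split_indicator)
    also have "\<dots> = ennreal (\<integral>\<omega>. v \<omega> * indicator T (Z \<omega>) \<partial>M)"
    proof (rule nn_integral_eq_integral)
      show "integrable M (\<lambda>\<omega>. v \<omega> * indicator T (Z \<omega>))"
        by (rule Bochner_Integration.integrable_bound[OF v(1)]) (use v(2) in \<open>auto split: split_indicator\<close>)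
    qed (use v in auto)
    finally show ?thesis .
  qed
  have N: "?N1 = ?N2"
  \<comment> \<open>Both measures are finite, so a constant sequence exhausts the space.\<close>
  proof (rule measure_eqI_PiM_finite[where A="\<lambda>_. space ?P"])
    fix A :: "nat \<Rightarrow> real set" assume "\<And>i. i \<in> {..<n} \<Longrightarrow> A i \<in> sets borel"
    then have A: "\<And>i. i < n \<Longrightarrow> A i \<in> sets borel" by auto
    have T: "Pi\<^sub>E {..<n} A \<in> sets ?P" using A by (intro sets_PiM_I_finite) auto
    have ind1: "indep_vars (\<lambda>_. borel) (\<lambda>i \<omega>. exp (- l * inc i \<omega>) * indicator (A i) (inc i \<omega>)) {..<n}"
    proof (rule indep_vars_compose2[OF ind, where Y="\<lambda>i x. exp (- l * x) * indicator (A i) x"])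
      fix i assume "i \<in> {..<n}"
      then have "A i \<in> sets borel" using A by auto
      then show "(\<lambda>x. exp (- l * x) * indicator (A i) x) \<in> borel_measurable borel" by measurable
    qed
    have ind2: "indep_vars (\<lambda>_. borel) (\<lambda>i \<omega>. indicat_real (A i) (inc i \<omega> / (1 + l))) {..<n}"
    proof (rule indep_vars_compose2[OF ind, where Y="\<lambda>i x. indicat_real (A i) (x / (1 + l))"])
      fix i assume "i \<in> {..<n}"
      then have "A i \<in> sets borel" using A by auto
      then show "(\<lambda>x. indicat_real (A i) (x / (1 + l))) \<in> borel_measurable borel" by measurable
    qed
    have int1: "integrable M (\<lambda>\<omega>. exp (- l * inc i \<omega>) * indicator (A i) (inc i \<omega>))" if "i < n" for i
    proof (rule integrable_const_bound[where B=1])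
      show "AE \<omega> in M. norm (exp (- l * inc i \<omega>) * indicator (A i) (inc i \<omega>)) \<le> 1"
      proof (rule AE_I2)
        fix \<omega> assume "\<omega> \<in> space M"
        then have "0 \<le> inc i \<omega>"
          using nondecreasing[of \<omega> "ts i" "ts (Suc i)"] mono[OF that] ge[of i] that by (simp add: inc_def)
        then have "exp (- l * inc i \<omega>) \<le> 1" using l by simp
        then show "norm (exp (- l * inc i \<omega>) * indicator (A i) (inc i \<omega>)) \<le> 1"
          by (simp split: split_indicator)
      qed
      show "(\<lambda>\<omega>. exp (- l * inc i \<omega>) * indicator (A i) (inc i \<omega>)) \<in> borel_measurable M"
        using A[OF that] inc_meas[OF that] by measurable
    qed
    have int2: "integrable M (\<lambda>\<omega>. indicat_real (A i) (inc i \<omega> / (1 + l)))" if "i < n" for i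
    proof (rule integrable_const_bound[where B=1])
      show "(\<lambda>\<omega>. indicat_real (A i) (inc i \<omega> / (1 + l))) \<in> borel_measurable M"
        using A[OF that] inc_meas[OF that] by measurable
    qed (auto split: split_indicator)
    have pind: "indicat_real (Pi\<^sub>E {..<n} A) (\<lambda>i\<in>{..<n}. x i) = (\<Prod>i<n. indicator (A i) (x i))" for x
      by (auto simp: indicator_def PiE_iff prod.neutral intro!: prod_zero[symmetric])
    have "(\<integral>\<omega>. ?w \<omega> * indicator (Pi\<^sub>E {..<n} A) (\<lambda>i\<in>{..<n}. inc i \<omega>) \<partial>M)
        = (\<integral>\<omega>. (\<Prod>i<n. exp (- l * inc i \<omega>) * indicator (A i) (inc i \<omega>)) \<partial>M)"
    proof (intro Bochner_Integration.integral_cong refl)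
      fix \<omega> assume \<omega>: "\<omega> \<in> space M"
      have "?w \<omega> = (\<Prod>i<n. exp (- l * inc i \<omega>))"
        unfolding sum_inc[OF \<omega>, symmetric] by (simp add: exp_sum sum_distrib_left sum_negf flip: exp_sum)
      then show "?w \<omega> * indicator (Pi\<^sub>E {..<n} A) (\<lambda>i\<in>{..<n}. inc i \<omega>)
          = (\<Prod>i<n. exp (- l * inc i \<omega>) * indicator (A i) (inc i \<omega>))"
        by (simp add: pind prod.distrib)
    qed
    also have "\<dots> = (\<Prod>i<n. \<integral>\<omega>. exp (- l * inc i \<omega>) * indicator (A i) (inc i \<omega>) \<partial>M)"
      using ind1 int1 by (intro indep_vars_lebesgue_integral) auto
    also have "\<dots> = (\<Prod>i<n. (1 + l) powr (- (ts (Suc i) - ts i)) * (\<integral>\<omega>. indicator (A i) (inc i \<omega> / (1 + l)) \<partial>M))"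
      unfolding inc_def using A ge mono l by (intro prod.cong increment_tilt) auto
    also have "\<dots> = (\<Prod>i<n. (1 + l) powr (- (ts (Suc i) - ts i))) * (\<integral>\<omega>. (\<Prod>i<n. indicator (A i) (inc i \<omega> / (1 + l))) \<partial>M)"
      using ind2 int2 by (subst indep_vars_lebesgue_integral) (auto simp: prod.distrib)
    also have "(\<Prod>i<n. (1 + l) powr (- (ts (Suc i) - ts i))) = ?c"
      using l sum_ts by (subst powr_sum[symmetric]) (auto simp: sum_negf sum_subtractf algebra_simps)
    finally have "(\<integral>\<omega>. ?w \<omega> * indicator (Pi\<^sub>E {..<n} A) (\<lambda>i\<in>{..<n}. inc i \<omega>) \<partial>M)
      = (\<integral>\<omega>. ?c * indicator (Pi\<^sub>E {..<n} A) (\<lambda>i\<in>{..<n}. inc i \<omega> / (1 + l)) \<partial>M)"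
      by (simp only: pind Bochner_Integration.integral_mult_right_zero)
    then show "emeasure ?N1 (Pi\<^sub>E {..<n} A) = emeasure ?N2 (Pi\<^sub>E {..<n} A)"
      using int_eq[OF D1 T intw] int_eq[OF D2 T, of "\<lambda>_. ?c"] c by simp
  next
    fix i :: nat
    show "emeasure ?N1 (space ?P) \<noteq> \<infinity>"
      using int_eq[OF D1 sets.top intw] by simp
    show "range (\<lambda>_::nat. space ?P) \<subseteq> prod_algebra {..<n} (\<lambda>_. borel)"
      by (auto simp: space_PiM intro!: prod_algebraI_finite)
  qed auto
  have "ennreal (\<integral>\<omega>. ?w \<omega> * indicator S (\<lambda>i\<in>{..<n}. inc i \<omega>) \<partial>M)
    = ennreal (\<integral>\<omega>. ?c * indicator S (\<lambda>i\<in>{..<n}. inc i \<omega> / (1 + l)) \<partial>M)"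
    using int_eq[OF D1 S intw] int_eq[OF D2 S, of "\<lambda>_. ?c"] N c by simp
  then have "(\<integral>\<omega>. ?w \<omega> * indicator S (\<lambda>i\<in>{..<n}. inc i \<omega>) \<partial>M)
    = (\<integral>\<omega>. ?c * indicator S (\<lambda>i\<in>{..<n}. inc i \<omega> / (1 + l)) \<partial>M)"
    by (subst (asm) ennreal_inj) (auto intro!: Bochner_Integration.integral_nonneg)
  then show ?thesis by simp
qed

section \<open>Independence of past, future and ratios\<close>

lemma past_indep_future:
  assumes t: "0 \<le> t"
  shows "indep_set (sets (gen_sigma M \<gamma> {0..t})) (sets (gen_sigma M (\<lambda>u \<omega>. \<gamma> (t + u) \<omega> - \<gamma> t \<omega>) {0..}))"
  unfolding sets_gen_sigma_rectangles
proof (intro indep_set_sigma_sets Int_stable_rectangles indep_setI)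
  let ?Z = "\<lambda>u \<omega>. \<gamma> (t + u) \<omega> - \<gamma> t \<omega>"
  show "rectangles M \<gamma> {0..t} \<subseteq> events" by (rule rectangles_sets) auto
  show "rectangles M ?Z {0..} \<subseteq> events"
  proof (rule rectangles_sets)
    show "?Z u \<in> borel_measurable M" if "u \<in> {0..}" for u
      using meas[of "t + u"] meas[of t] t that by auto
  qed auto
  fix a b assume "a \<in> rectangles M \<gamma> {0..t}" "b \<in> rectangles M ?Z {0..}"
  then obtain J A J' A' where a: "a = {\<omega> \<in> space M. \<forall>s\<in>J. \<gamma> s \<omega> \<in> A s}" "finite J" "J \<subseteq> {0..t}" "\<And>s. A s \<in> sets borel"
    and b: "b = {\<omega> \<in> space M. \<forall>u\<in>J'. ?Z u \<omega> \<in> A' u}" "finite J'" "J' \<subseteq> {0..}" "\<And>u. A' u \<in> sets borel"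
    unfolding rectangles_def by auto
  have "finite (J \<union> (+) t ` J')" "J \<union> (+) t ` J' \<subseteq> {0..}" using a b t by auto
  then obtain ts n N idx where ts0: "ts 0 = 0" and mono: "\<forall>i<N. ts i \<le> ts (Suc i)" and n: "n \<le> N" "ts n = t"
    and idx1: "\<forall>s\<in>J \<union> (+) t ` J'. s \<le> t \<longrightarrow> idx s \<le> n \<and> ts (idx s) = s"
    and idx2: "\<forall>s\<in>J \<union> (+) t ` J'. t < s \<longrightarrow> n \<le> idx s \<and> idx s \<le> N \<and> ts (idx s) = s"
    by (rule finite_mesh_through[OF _ _ t]) (rule that)
  define inc where "inc i \<omega> = \<gamma> (ts (Suc i)) \<omega> - \<gamma> (ts i) \<omega>" for i \<omega>
  have ind: "indep_vars (\<lambda>_. borel) inc {..<N}"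
    unfolding inc_def using ts0 mono by (intro indep_increments) auto
  have past: "\<gamma> s \<omega> = (\<Sum>j<idx s. inc j \<omega>)" "idx s \<le> n" if "s \<in> J" "\<omega> \<in> space M" for s \<omega>
    using idx1[rule_format, of s] a(3) that sum_lessThan_telescope[of "\<lambda>i. \<gamma> (ts i) \<omega>" "idx s"] start[OF that(2)] ts0
    by (auto simp: inc_def)
  \<comment> \<open>For \<open>u = 0\<close> the mesh index of the time \<open>t + u\<close> is only
    known to be at most \<open>n\<close>; choosing \<open>n\<close> makes the increment an empty
    sum.\<close>
  define idx' where "idx' u = (if u = 0 then n else idx (t + u))" for u
  have future: "?Z u \<omega> = (\<Sum>j\<in>{n..<idx' u}. inc j \<omega>)" "idx' u \<le> N" if "u \<in> J'" for u \<omega>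
  proof -
    have i: "n \<le> idx' u" "idx' u \<le> N" "ts (idx' u) = t + u"
      using idx2[rule_format, of "t + u"] n b(3) that by (auto simp: idx'_def)
    show "idx' u \<le> N" by fact
    show "?Z u \<omega> = (\<Sum>j\<in>{n..<idx' u}. inc j \<omega>)"
      using sum_Suc_diff'[OF i(1), of "\<lambda>i. \<gamma> (ts i) \<omega>"] i n by (simp add: inc_def)
  qed
  define D1 where "D1 \<omega> = restrict (\<lambda>i. inc i \<omega>) {..<n}" for \<omega>
  define D2 where "D2 \<omega> = restrict (\<lambda>i. inc i \<omega>) {n..<N}" for \<omega>
  let ?P1 = "PiM {..<n} (\<lambda>_. borel :: real measure)" and ?P2 = "PiM {n..<N} (\<lambda>_. borel :: real measure)"
  have ivar: "indep_var ?P1 D1 ?P2 D2"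
    unfolding D1_def D2_def by (rule indep_var_restrict[OF ind]) (use n in auto)
  \<comment> \<open>The condition \<open>idx s \<le> n\<close> holds throughout \<open>J\<close> by
    \<open>past\<close>. Written into the set, it ensures that only coordinates below
    \<open>n\<close> occur when measurability is checked; \<open>S2\<close> follows the same
    pattern.\<close>
  define S1 where "S1 = {x \<in> space ?P1. \<forall>s\<in>{s \<in> J. idx s \<le> n}. (\<Sum>j<idx s. x j) \<in> A s}"
  define S2 where "S2 = {x \<in> space ?P2. \<forall>u\<in>{u \<in> J'. idx' u \<le> N}. (\<Sum>j\<in>{n..<idx' u}. x j) \<in> A' u}"
  have sumP: "(\<lambda>x. \<Sum>j\<in>L. x j) \<in> borel_measurable (PiM I (\<lambda>_. borel :: real measure))" if "L \<subseteq> I" for L I :: "nat set"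
    using that by (intro borel_measurable_sum measurable_component_singleton) auto
  have S1: "S1 \<in> sets ?P1"
    unfolding S1_def
  proof (rule sets.sets_Collect_finite_All)
    fix s assume "s \<in> {s \<in> J. idx s \<le> n}"
    then have "(\<lambda>x. \<Sum>j<idx s. x j) \<in> borel_measurable ?P1" by (intro sumP) auto
    then show "{x \<in> space ?P1. (\<Sum>j<idx s. x j) \<in> A s} \<in> sets ?P1" using a(4)[of s] by measurable
  qed (use a in auto)
  have S2: "S2 \<in> sets ?P2"
    unfolding S2_def
  proof (rule sets.sets_Collect_finite_All)
    fix u assume "u \<in> {u \<in> J'. idx' u \<le> N}"
    then have "(\<lambda>x. \<Sum>j\<in>{n..<idx' u}. x j) \<in> borel_measurable ?P2" by (intro sumP) auto
    then show "{x \<in> space ?P2. (\<Sum>j\<in>{n..<idx' u}. x j) \<in> A' u} \<in> sets ?P2" using b(4)[of u] by measurable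
  qed (use b in auto)
  have r1: "(\<Sum>j<k. D1 \<omega> j) = (\<Sum>j<k. inc j \<omega>)" if "k \<le> n" for k \<omega>
    using that by (intro sum.cong) (auto simp: D1_def)
  have r2: "(\<Sum>j\<in>{n..<k}. D2 \<omega> j) = (\<Sum>j\<in>{n..<k}. inc j \<omega>)" if "k \<le> N" for k \<omega>
    using that by (intro sum.cong) (auto simp: D2_def)
  have sp: "D1 \<omega> \<in> space ?P1" "D2 \<omega> \<in> space ?P2" for \<omega>
    by (auto simp: D1_def D2_def space_PiM)
  have aeq: "a = D1 -` S1 \<inter> space M"
    using past by (auto simp: a(1) S1_def sp r1)
  have beq: "b = D2 -` S2 \<inter> space M"
    using future by (auto simp: b(1) S2_def sp r2)
  have "a \<inter> b = (\<lambda>x. (D1 x, D2 x)) -` (S1 \<times> S2) \<inter> space M"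
    unfolding aeq beq by auto
  then show "prob (a \<inter> b) = prob a * prob b"
    using indep_varD[OF ivar S1 S2] unfolding aeq beq by simp
qed

text \<open>The process form of the gamma-beta (Lukacs) independence: normalised gamma increments
  are independent of their total. It is proved for one rectangle \<open>C\<close> of ratios at a
  time, by comparing \<open>\<gamma> t\<close> weighted with the indicator of \<open>C\<close> to
  \<open>\<gamma> t\<close> weighted with the constant \<open>prob C\<close>.\<close>

lemma ratios_indep_total:
  assumes t: "0 < t"
  shows "indep_set (sets (gen_sigma M (\<lambda>s \<omega>. \<gamma> s \<omega> / \<gamma> t \<omega>) {0..t})) (sets (gen_sigma M \<gamma> {t}))"
proof -
  have [measurable]: "\<gamma> t \<in> borel_measurable M" using t by auto
  let ?R = "\<lambda>s \<omega>. \<gamma> s \<omega> / \<gamma> t \<omega>"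
  have Rm: "?R s \<in> borel_measurable M" if "s \<in> {0..t}" for s
    using meas[of s] meas[of t] t that by auto
  let ?E = "{\<gamma> t -` A \<inter> space M | A. A \<in> sets borel}"
  have E: "?E = sets (gen_sigma M \<gamma> {t})" by (rule sets_gen_sigma_singleton[symmetric])
  have "indep_set (sigma_sets (space M) (rectangles M ?R {0..t})) (sigma_sets (space M) (sets (gen_sigma M \<gamma> {t})))"
  proof (intro indep_set_sigma_sets Int_stable_rectangles indep_setI)
    show R_ev: "rectangles M ?R {0..t} \<subseteq> events" using Rm by (intro rectangles_sets) auto
    show "sets (gen_sigma M \<gamma> {t}) \<subseteq> events" using t by (intro sets_gen_sigma_le) auto
    show "Int_stable (sets (gen_sigma M \<gamma> {t}))" by (auto intro!: Int_stableI)
    fix C b assume C: "C \<in> rectangles M ?R {0..t}" and "b \<in> sets (gen_sigma M \<gamma> {t})"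
    then obtain A where b: "b = \<gamma> t -` A \<inter> space M" and A [measurable]: "A \<in> sets borel" unfolding E[symmetric] by auto
    have C_ev [measurable]: "C \<in> events" using C R_ev by auto
    obtain J B where J: "C = {\<omega> \<in> space M. \<forall>s\<in>J. ?R s \<omega> \<in> B s}" "finite J" "J \<subseteq> {0..t}" "\<And>s. B s \<in> sets borel"
      using C unfolding rectangles_def by auto
    have "finite J" "J \<subseteq> {0..}" "0 \<le> t" using J t by auto
    then obtain ts n N idx where ts0: "ts 0 = 0" and mono: "\<forall>i<N. ts i \<le> ts (Suc i)" and n: "n \<le> N" "ts n = t"
      and idx1: "\<forall>s\<in>J. s \<le> t \<longrightarrow> idx s \<le> n \<and> ts (idx s) = s"
      and "\<forall>s\<in>J. t < s \<longrightarrow> n \<le> idx s \<and> idx s \<le> N \<and> ts (idx s) = s"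
      by (rule finite_mesh_through) (rule that)
    define inc where "inc i \<omega> = \<gamma> (ts (Suc i)) \<omega> - \<gamma> (ts i) \<omega>" for i \<omega>
    let ?P = "PiM {..<n} (\<lambda>_. borel :: real measure)"
    define S where "S = {x \<in> space ?P. \<forall>s\<in>{s \<in> J. idx s \<le> n}. (\<Sum>j<idx s. x j) / (\<Sum>j<n. x j) \<in> B s}"
    have sumP: "(\<lambda>x. \<Sum>j\<in>L. x j) \<in> borel_measurable (PiM I (\<lambda>_. borel :: real measure))" if "L \<subseteq> I" for L I :: "nat set"
      using that by (intro borel_measurable_sum measurable_component_singleton) auto
    have S: "S \<in> sets ?P"
      unfolding S_def
    proof (rule sets.sets_Collect_finite_All)
      fix s assume "s \<in> {s \<in> J. idx s \<le> n}"
      then have "(\<lambda>x. \<Sum>j<idx s. x j) \<in> borel_measurable ?P" "(\<lambda>x. \<Sum>j<n. x j) \<in> borel_measurable ?P"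
        by (auto intro!: sumP)
      then show "{x \<in> space ?P. (\<Sum>j<idx s. x j) / (\<Sum>j<n. x j) \<in> B s} \<in> sets ?P" using J(4)[of s] by measurable
    qed (use J in auto)
    have tele: "\<gamma> (ts i) \<omega> = (\<Sum>j<i. inc j \<omega>)" if "\<omega> \<in> space M" for i \<omega>
      using sum_lessThan_telescope[of "\<lambda>i. \<gamma> (ts i) \<omega>" i] start[OF that] ts0 by (simp add: inc_def)
    \<comment> \<open>The divisor \<open>c\<close> cancels in the ratios. The instance
      \<open>c = 1\<close> expresses \<open>C\<close> through the increments, and
      \<open>c = 1 + l\<close> recognises \<open>C\<close> again after the tilt.\<close>
    have DS: "restrict (\<lambda>i. inc i \<omega> / c) {..<n} \<in> S \<longleftrightarrow> \<omega> \<in> C" if \<omega>: "\<omega> \<in> space M" and c: "0 < c" for \<omega> c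
    proof -
      define x where "x = restrict (\<lambda>i. inc i \<omega> / c) {..<n}"
      have x: "x \<in> space ?P" by (auto simp: x_def space_PiM)
      have eq: "(\<Sum>j<k. x j) = \<gamma> (ts k) \<omega> / c" if "k \<le> n" for k
        using that by (simp add: x_def tele[OF \<omega>] sum_divide_distrib cong: sum.cong_simp)
      have ratio: "idx s \<le> n" "(\<Sum>j<idx s. x j) / (\<Sum>j<n. x j) = ?R s \<omega>" if "s \<in> J" for s
      proof -
        have s: "idx s \<le> n" "ts (idx s) = s" using idx1[rule_format, of s] J(3) that by auto
        show "idx s \<le> n" by fact
        show "(\<Sum>j<idx s. x j) / (\<Sum>j<n. x j) = ?R s \<omega>"
          unfolding eq[OF s(1)] eq[OF order_refl] using s n c by simp
      qed
      have "x \<in> S \<longleftrightarrow> \<omega> \<in> C" using \<omega> x ratio by (auto simp: S_def J(1))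
      then show ?thesis by (simp only: x_def)
    qed
    have tilt: "expectation (\<lambda>\<omega>. indicator C \<omega> * exp (- l * \<gamma> t \<omega>)) = expectation (\<lambda>\<omega>. prob C * exp (- l * \<gamma> t \<omega>))"
      if l: "0 \<le> l" for l
    proof -
      have "expectation (\<lambda>\<omega>. indicator C \<omega> * exp (- l * \<gamma> t \<omega>))
          = expectation (\<lambda>\<omega>. exp (- l * \<gamma> (ts n) \<omega>) * indicator S (\<lambda>i\<in>{..<n}. inc i \<omega>))"
        using DS[of _ 1] n by (intro Bochner_Integration.integral_cong refl) (auto simp: indicator_def)
      also have "\<dots> = (1 + l) powr (- ts n) * expectation (\<lambda>\<omega>. indicator S (\<lambda>i\<in>{..<n}. inc i \<omega> / (1 + l)))"
        unfolding inc_def using ts0 mono n l S by (intro increments_tilt) auto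
      also have "expectation (\<lambda>\<omega>. indicator S (\<lambda>i\<in>{..<n}. inc i \<omega> / (1 + l))) = expectation (indicat_real C)"
        using DS[of _ "1 + l"] l by (intro Bochner_Integration.integral_cong refl) (auto simp: indicator_def)
      also have "expectation (indicat_real C) = prob C" by simp
      finally show ?thesis using laplace[of t l] t l n by (simp add: mult.commute)
    qed
    have "expectation (\<lambda>\<omega>. indicator C \<omega> * indicator A (\<gamma> t \<omega>)) = expectation (\<lambda>\<omega>. prob C * indicator A (\<gamma> t \<omega>))"
      by (rule weighted_laplace_transform_unique) (use tilt nonneg t in \<open>auto simp: less_top[symmetric]\<close>)
    moreover have "expectation (\<lambda>\<omega>. indicator C \<omega> * indicator A (\<gamma> t \<omega>)) = expectation (indicat_real (C \<inter> b))"
      using sets.sets_into_space[OF C_ev] by (intro Bochner_Integration.integral_cong refl) (auto simp: b indicator_def)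
    moreover have "expectation (\<lambda>\<omega>. indicator A (\<gamma> t \<omega>)) = expectation (indicat_real b)"
      by (intro Bochner_Integration.integral_cong refl) (auto simp: b indicator_def)
    moreover have "b \<in> events" unfolding b by measurable
    ultimately show "prob (C \<inter> b) = prob C * prob b" by simp
  qed
  then show ?thesis
    unfolding sets_gen_sigma_rectangles[of _ ?R]
    using sets.sigma_sets_eq[of "gen_sigma M \<gamma> {t}"] by simp
qed

section \<open>The process stopped and normalised at a random time\<close>

text \<open>Triple intersections serve as generators because they form a pi-system on which
  probabilities can be factorised directly, and because the three families have different index
  types.\<close>

definition after_alg :: "real \<Rightarrow> ('a \<Rightarrow> real) \<Rightarrow> 'a measure" where
  "after_alg t \<tau> = sigma (space M) {a \<inter> b \<inter> c | a b c. a \<in> sets (gen_sigma M \<gamma> {t}) \<and>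
     b \<in> sets (gen_sigma M (\<lambda>u \<omega>. \<gamma> (t + u) \<omega> - \<gamma> t \<omega>) {0..}) \<and> c \<in> sets (gen_sigma M (\<lambda>_::unit. \<tau>) UNIV)}"

context
  fixes \<tau> :: "'a \<Rightarrow> real" and t :: real
  assumes tau: "\<tau> \<in> borel_measurable M"
    and ind: "indep_set (sets (gen_sigma M (\<lambda>_::unit. \<tau>) UNIV)) (sets (gen_sigma M \<gamma> {0..}))"
    and t: "0 < t"
begin

abbreviation (input) "post_increment \<equiv> \<lambda>u \<omega>. \<gamma> (t + u) \<omega> - \<gamma> t \<omega>"
abbreviation (input) "after_gen \<equiv> {a \<inter> b \<inter> c | a b c. a \<in> sets (gen_sigma M \<gamma> {t}) \<and>
     b \<in> sets (gen_sigma M post_increment {0..}) \<and> c \<in> sets (gen_sigma M (\<lambda>_::unit. \<tau>) UNIV)}"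

lemma post_increment_measurable:
  assumes "\<And>s. 0 \<le> s \<Longrightarrow> \<gamma> s \<in> borel_measurable N" "0 \<le> u"
  shows "post_increment u \<in> borel_measurable N"
  using assms(1)[of "t + u"] assms(1)[of t] assms(2) t by auto

lemma after_gen_events: "after_gen \<subseteq> events"
proof -
  have "sets (gen_sigma M \<gamma> {t}) \<subseteq> events" "sets (gen_sigma M post_increment {0..}) \<subseteq> events"
    "sets (gen_sigma M (\<lambda>_::unit. \<tau>) UNIV) \<subseteq> events"
    using t tau by (intro sets_gen_sigma_le post_increment_measurable; auto)+
  then show ?thesis by blast
qed

lemma space_after_alg: "space (after_alg t \<tau>) = space M"
  unfolding after_alg_def using after_gen_events sets.sets_into_space by (intro space_measure_of) blast

lemma sets_after_alg: "sets (after_alg t \<tau>) = sigma_sets (space M) after_gen"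
  unfolding after_alg_def using after_gen_events sets.sets_into_space by (intro sets_measure_of) blast

lemma subalgebra_after_alg: "subalgebra M (after_alg t \<tau>)"
  unfolding subalgebra_def space_after_alg sets_after_alg
  using sets.sigma_sets_subset[OF after_gen_events] by simp

lemma after_alg_measurable:
  shows "\<gamma> t \<in> borel_measurable (after_alg t \<tau>)"
    and "\<tau> \<in> borel_measurable (after_alg t \<tau>)"
    and "0 \<le> u \<Longrightarrow> post_increment u \<in> borel_measurable (after_alg t \<tau>)"
proof -
  let ?a = "gen_sigma M \<gamma> {t}" and ?b = "gen_sigma M post_increment {0..}" and ?c = "gen_sigma M (\<lambda>_::unit. \<tau>) UNIV"
  have top: "space M \<in> sets ?a" "space M \<in> sets ?b" "space M \<in> sets ?c"
    using sets.top[of ?a] sets.top[of ?b] sets.top[of ?c] by simp_all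
  have "x \<in> after_gen" if "x \<in> sets ?a" for x
    using that top sets.sets_into_space[OF that]
    by (intro CollectI exI[of _ x] exI[of _ "space M"]) auto
  then have a: "sets ?a \<subseteq> sets (after_alg t \<tau>)" unfolding sets_after_alg by (intro subsetI sigma_sets.Basic)
  have "x \<in> after_gen" if "x \<in> sets ?b" for x
    using that top sets.sets_into_space[OF that]
    by (intro CollectI exI[of _ "space M"] exI[of _ x]) auto
  then have b: "sets ?b \<subseteq> sets (after_alg t \<tau>)" unfolding sets_after_alg by (intro subsetI sigma_sets.Basic)
  have "x \<in> after_gen" if "x \<in> sets ?c" for x
    using that top sets.sets_into_space[OF that]
    by (intro CollectI exI[of _ "space M"] exI[of _ x]) auto
  then have c: "sets ?c \<subseteq> sets (after_alg t \<tau>)" unfolding sets_after_alg by (intro subsetI sigma_sets.Basic)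
  have lift: "Y \<in> borel_measurable (after_alg t \<tau>)"
    if "Y \<in> borel_measurable N" "sets N \<subseteq> sets (after_alg t \<tau>)" "space N = space M" for Y :: "'a \<Rightarrow> real" and N
    by (rule measurable_from_subalg[OF _ that(1)]) (use that space_after_alg in \<open>auto simp: subalgebra_def\<close>)
  show "\<gamma> t \<in> borel_measurable (after_alg t \<tau>)"
    by (rule lift[OF measurable_gen_sigma a]) auto
  show "\<tau> \<in> borel_measurable (after_alg t \<tau>)"
    by (rule lift[OF measurable_gen_sigma[where X="\<lambda>_::unit. \<tau>" and s="()"] c]) auto
  show "0 \<le> u \<Longrightarrow> post_increment u \<in> borel_measurable (after_alg t \<tau>)"
    by (rule lift[OF measurable_gen_sigma[where X=post_increment and s=u] b]) auto
qed

lemma ratios_indep_after: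
  "indep_set (sets (gen_sigma M (\<lambda>s \<omega>. \<gamma> s \<omega> / \<gamma> t \<omega>) {0..t})) (sets (after_alg t \<tau>))"
proof -
  let ?Y = "gen_sigma M (\<lambda>s \<omega>. \<gamma> s \<omega> / \<gamma> t \<omega>) {0..t}" and ?P = "gen_sigma M \<gamma> {0..t}" and ?G = "gen_sigma M \<gamma> {0..}"
  let ?a = "gen_sigma M \<gamma> {t}" and ?b = "gen_sigma M post_increment {0..}" and ?c = "gen_sigma M (\<lambda>_::unit. \<tau>) UNIV"
  have YP: "sets ?Y \<subseteq> sets ?P"
  proof (rule sets_gen_sigma_le)
    fix s assume "s \<in> {0..t}"
    then have "\<gamma> s \<in> borel_measurable ?P" "\<gamma> t \<in> borel_measurable ?P" using t by (auto intro!: measurable_gen_sigma)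
    then show "(\<lambda>\<omega>. \<gamma> s \<omega> / \<gamma> t \<omega>) \<in> borel_measurable ?P" by measurable
  qed simp
  have aP: "sets ?a \<subseteq> sets ?P" using t by (intro sets_gen_sigma_le) (auto intro!: measurable_gen_sigma)
  have PG: "sets ?P \<subseteq> sets ?G" by (intro sets_gen_sigma_le) (auto intro!: measurable_gen_sigma)
  have bG: "sets ?b \<subseteq> sets ?G" by (intro sets_gen_sigma_le post_increment_measurable) (auto intro!: measurable_gen_sigma)
  have G: "sets ?G \<subseteq> events" by (intro sets_gen_sigma_le) auto
  \<comment> \<open>Three independences are peeled off in turn: \<tau> from the whole process, the
    later increments from the past up to \<open>t\<close>, and \<open>\<gamma> t\<close> from the
    ratios.\<close>
  have abc: "prob (y \<inter> (a \<inter> b \<inter> c)) = prob y * (prob a * prob b * prob c)"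
    if "y \<in> sets ?Y" "a \<in> sets ?a" "b \<in> sets ?b" "c \<in> sets ?c" for y a b c
  proof -
    have ya: "y \<inter> a \<in> sets ?P" using that YP aP by auto
    have "prob (y \<inter> (a \<inter> b \<inter> c)) = prob (c \<inter> ((y \<inter> a) \<inter> b))" by (simp add: ac_simps)
    also have "\<dots> = prob c * prob ((y \<inter> a) \<inter> b)"
      using indep_setD[OF ind that(4), of "(y \<inter> a) \<inter> b"] ya PG bG that by auto
    also have "prob ((y \<inter> a) \<inter> b) = prob (y \<inter> a) * prob b"
      using t by (intro indep_setD[OF past_indep_future ya that(3)]) auto
    also have "prob (y \<inter> a) = prob y * prob a"
      by (rule indep_setD[OF ratios_indep_total[OF t] that(1,2)])
    finally show ?thesis by simp
  qed
  have "indep_set (sigma_sets (space M) (sets ?Y)) (sigma_sets (space M) after_gen)"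
  proof (intro indep_set_sigma_sets indep_setI)
    show "sets ?Y \<subseteq> events" using YP PG G by auto
    show "after_gen \<subseteq> events" by (rule after_gen_events)
    show "Int_stable (sets ?Y)" by (auto intro!: Int_stableI)
    show "Int_stable after_gen"
    proof (rule Int_stableI)
      fix x y assume "x \<in> after_gen" "y \<in> after_gen"
      then obtain a b c a' b' c' where xy: "x = a \<inter> b \<inter> c" "y = a' \<inter> b' \<inter> c'"
        and "a \<in> sets ?a" "b \<in> sets ?b" "c \<in> sets ?c" "a' \<in> sets ?a" "b' \<in> sets ?b" "c' \<in> sets ?c"
        by blast
      then have "a \<inter> a' \<in> sets ?a" "b \<inter> b' \<in> sets ?b" "c \<inter> c' \<in> sets ?c" by auto
      moreover have "x \<inter> y = (a \<inter> a') \<inter> (b \<inter> b') \<inter> (c \<inter> c')" unfolding xy by blast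
      ultimately show "x \<inter> y \<in> after_gen" by blast
    qed
    fix y x assume y: "y \<in> sets ?Y" and "x \<in> after_gen"
    then obtain a b c where x: "x = a \<inter> b \<inter> c" and s: "a \<in> sets ?a" "b \<in> sets ?b" "c \<in> sets ?c" by blast
    \<comment> \<open>Taking the whole space for \<open>y\<close> in \<open>abc\<close> evaluates
      \<open>prob x\<close> itself.\<close>
    have "space M \<in> sets ?Y" using sets.top[of ?Y] by simp
    from abc[OF this s] have "prob (space M \<inter> x) = prob a * prob b * prob c" by (simp add: x prob_space)
    moreover have "space M \<inter> x = x" using sets.sets_into_space[OF s(1)] by (auto simp: x)
    ultimately show "prob (y \<inter> x) = prob y * prob x" using abc[OF y s] by (simp add: x)
  qed
  then show ?thesis
    using sets.sigma_sets_eq[of ?Y] by (simp add: sets_after_alg)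
qed

text \<open>\<open>\<gamma>\<close> sampled at \<tau> need not be
  \<open>after_alg\<close>-measurable, since \<open>\<tau> < t\<close> would require the path before
  \<open>t\<close>. Increments after \<open>t\<close>, sampled at a nonnegative random delay, avoid
  this.\<close>

lemma post_increment_random_time_measurable:
  assumes "T \<in> borel_measurable (after_alg t \<tau>)" "\<And>\<omega>. \<omega> \<in> space M \<Longrightarrow> 0 \<le> T \<omega>"
  shows "(\<lambda>\<omega>. post_increment (T \<omega>) \<omega>) \<in> borel_measurable (after_alg t \<tau>)"
proof (rule measurable_right_continuous_at_random_time[where X=post_increment])
  fix \<omega> u assume \<omega>: "\<omega> \<in> space (after_alg t \<tau>)" and u: "0 \<le> (u::real)"
  have "(+) t ` {u<..} = {t + u<..}" by (auto intro!: image_eqI[of _ "(+) t" "x - t" for x])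
  then have "continuous (at (t + u) within (+) t ` {u<..}) (\<lambda>s. \<gamma> s \<omega>)"
    using right_continuous[of \<omega> "t + u"] \<omega> u t by (simp add: space_after_alg)
  moreover have "continuous (at_right u) ((+) t)" by (intro continuous_intros)
  ultimately have "continuous (at_right u) (\<lambda>s. \<gamma> (t + s) \<omega>)"
    using continuous_within_compose2[of u "{u<..}" "(+) t" "\<lambda>s. \<gamma> s \<omega>"] by simp
  then show "continuous (at_right u) (\<lambda>s. post_increment s \<omega>)"
    by (rule continuous_diff[OF _ continuous_const])
qed (use assms after_alg_measurable in \<open>auto simp: space_after_alg\<close>)

section \<open>Almost sure behaviour and measurability of the normalised process\<close>

text \<open>\<open>AE_strictly_increasing\<close> concerns fixed times while \<tau> is random.
  Countably many times decreasing to 0 and to \<open>t\<close> suffice: \<tau> lies beyond one of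
  the former, and beyond one of the latter if \<open>t < \<tau> \<omega>\<close>, so monotonicity
  transfers the strict inequality. Positivity of \<open>\<gamma>\<close> at \<tau> excludes the
  default value of \<open>0 / 0\<close>.\<close>

lemma AE_zeta_eq_1_iff:
  assumes tau_pos: "\<forall>\<omega>\<in>space M. 0 < \<tau> \<omega>"
  shows "AE \<omega> in M. (zeta \<gamma> \<tau> t \<omega> = 1 \<longleftrightarrow> \<tau> \<omega> \<le> t) \<and> (\<forall>h\<ge>0. \<tau> \<omega> \<le> t \<longrightarrow> zeta \<gamma> \<tau> (t + h) \<omega> = 1)"
proof -
  have "AE \<omega> in M. \<forall>n. \<gamma> 0 \<omega> < \<gamma> (inverse (real (Suc n))) \<omega>"
    unfolding AE_all_countable by (intro allI AE_strictly_increasing) auto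
  moreover have "AE \<omega> in M. \<forall>n. \<gamma> t \<omega> < \<gamma> (t + inverse (real (Suc n))) \<omega>"
    unfolding AE_all_countable using t by (intro allI AE_strictly_increasing) auto
  ultimately show ?thesis
    using AE_space
  proof eventually_elim
    case (elim \<omega>)
    have tp: "0 < \<tau> \<omega>" using tau_pos elim by auto
    have pos: "0 < \<gamma> (\<tau> \<omega>) \<omega>"
    proof -
      obtain n where n: "inverse (real (Suc n)) < \<tau> \<omega>" using reals_Archimedean[OF tp] by auto
      then have "\<gamma> (inverse (real (Suc n))) \<omega> \<le> \<gamma> (\<tau> \<omega>) \<omega>" using elim by (intro nondecreasing) auto
      then show ?thesis using elim(1)[rule_format, of n] start[OF elim(3)] by simp
    qed
    have lt: "\<gamma> t \<omega> < \<gamma> (\<tau> \<omega>) \<omega>" if t_less: "t < \<tau> \<omega>"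
    proof -
      obtain n where n: "inverse (real (Suc n)) < \<tau> \<omega> - t" 
        using reals_Archimedean[of "\<tau> \<omega> - t"] t_less by auto
      then have "\<gamma> (t + inverse (real (Suc n))) \<omega> \<le> \<gamma> (\<tau> \<omega>) \<omega>" using elim t by (intro nondecreasing) auto
      then show ?thesis using elim(2)[rule_format, of n] by simp
    qed
    have 1: "zeta \<gamma> \<tau> s \<omega> = 1" if "\<tau> \<omega> \<le> s" for s
      using that pos by (simp add: zeta_def min_absorb2)
    have "zeta \<gamma> \<tau> t \<omega> \<noteq> 1" if "t < \<tau> \<omega>"
      using that pos lt by (simp add: zeta_def)
    then show ?case using 1 by (meson add_increasing2 not_le order_trans le_add_same_cancel1)
  qed
qed

lemma zeta_measurable:
  assumes tau_pos: "\<forall>\<omega>\<in>space M. 0 < \<tau> \<omega>" and s: "0 \<le> s"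
  shows "zeta \<gamma> \<tau> s \<in> borel_measurable M"
proof -
  have "(\<lambda>\<omega>. \<gamma> (min s (\<tau> \<omega>)) \<omega>) \<in> borel_measurable M"
    by (rule measurable_right_continuous_at_random_time)
       (use tau tau_pos s right_continuous in \<open>auto intro: less_imp_le\<close>)
  moreover have "(\<lambda>\<omega>. \<gamma> (\<tau> \<omega>) \<omega>) \<in> borel_measurable M"
    by (rule measurable_right_continuous_at_random_time)
       (use tau tau_pos s right_continuous in \<open>auto intro: less_imp_le\<close>)
  ultimately have "(\<lambda>\<omega>. \<gamma> (min s (\<tau> \<omega>)) \<omega> / \<gamma> (\<tau> \<omega>) \<omega>) \<in> borel_measurable M" by measurable
  then show ?thesis by (simp add: zeta_def[abs_def])
qed

section \<open>The Markov property\<close>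

text \<open>The conditional expectation \<open>g\<close> given \<open>zeta\<close> at
  \<open>t\<close> is shown to be a version of the one given the past \<open>F\<close>: it must have
  the same integral as \<open>?X\<close> over each event of \<open>F\<close>. Off \<open>L\<close>
  both equal \<open>f 1\<close> almost surely. On \<open>L\<close> the event may be replaced by one
  generated by the ratios and \<open>z'\<close>, and \<open>set_integral_zero_indep_enlarge\<close>
  applies.\<close>

lemma zeta_markov:
  assumes tau_pos: "\<forall>\<omega>\<in>space M. 0 < \<tau> \<omega>"
    and f: "f \<in> borel_measurable borel" and bdd: "\<exists>C. \<forall>x. \<bar>f x\<bar> \<le> C" and h: "0 \<le> h"
  shows "AE \<omega> in M.
    real_cond_exp M (gen_sigma M (zeta \<gamma> \<tau>) {0..t}) (\<lambda>\<omega>. f (zeta \<gamma> \<tau> (t + h) \<omega>)) \<omega>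
    = real_cond_exp M (gen_sigma M (zeta \<gamma> \<tau>) {t}) (\<lambda>\<omega>. f (zeta \<gamma> \<tau> (t + h) \<omega>)) \<omega>"
proof -
  let ?z = "zeta \<gamma> \<tau>"
  define F where "F = gen_sigma M ?z {0..t}"
  define G where "G = gen_sigma M ?z {t}"
  have zm: "?z s \<in> borel_measurable M" if "0 \<le> s" for s using zeta_measurable[OF tau_pos that] .
  have "subalgebra M F" unfolding F_def using zm by (intro subalgebra_gen_sigma) auto
  have "subalgebra M G" unfolding G_def using zm t by (intro subalgebra_gen_sigma) auto
  have "sets G \<subseteq> sets F"
    unfolding F_def G_def using t by (intro sets_gen_sigma_le measurable_gen_sigma) auto
  then have "subalgebra F G" by (simp add: subalgebra_def F_def G_def)
  interpret F: finite_measure_subalgebra M F by standard fact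
  interpret G: finite_measure_subalgebra M G by standard fact
  let ?X = "\<lambda>\<omega>. f (?z (t + h) \<omega>)"
  obtain C where C: "\<And>x. \<bar>f x\<bar> \<le> C" using bdd by auto
  have Xm: "?X \<in> borel_measurable M" using f zm[OF add_nonneg_nonneg[OF less_imp_le[OF t] h]] by measurable
  have Xi: "integrable M ?X" by (rule integrable_const_bound[where B=C]) (use C Xm in auto)
  define g where "g = real_cond_exp M G ?X"
  have gG: "g \<in> borel_measurable G" unfolding g_def by simp
  have gi: "integrable M g" unfolding g_def by (rule G.real_cond_exp_int(1)[OF Xi])
  note AE1 = AE_zeta_eq_1_iff[OF tau_pos]

  \<comment> \<open>The indicator of \<open>?z t \<omega> = 1\<close> is
    \<open>G\<close>-measurable, hence can be pulled out of the conditional expectation; where it is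
    1, \<open>?X\<close> is almost surely the constant \<open>f 1\<close>.\<close>
  have g1: "AE \<omega> in M. \<tau> \<omega> \<le> t \<longrightarrow> g \<omega> = f 1"
  proof -
    let ?I = "\<lambda>\<omega>. indicat_real {1} (?z t \<omega>)"
    have zG: "?z t \<in> borel_measurable G" unfolding G_def by (rule measurable_gen_sigma) simp
    have IG: "?I \<in> borel_measurable G" using zG by measurable
    have IM: "?I \<in> borel_measurable M" using zm[OF less_imp_le[OF t]] by measurable
    have IX: "integrable M (\<lambda>\<omega>. ?I \<omega> * ?X \<omega>)"
      by (rule Bochner_Integration.integrable_bound[OF Xi]) (use IM Xm in \<open>auto split: split_indicator\<close>)
    have If: "integrable M (\<lambda>\<omega>. f 1 * ?I \<omega>)"
      by (rule integrable_const_bound[where B="\<bar>f 1\<bar>"]) (use IM in \<open>auto split: split_indicator\<close>)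
    have "AE \<omega> in M. real_cond_exp M G (\<lambda>\<omega>. ?I \<omega> * ?X \<omega>) \<omega> = ?I \<omega> * g \<omega>"
      unfolding g_def by (rule G.real_cond_exp_mult[OF IG Xm IX])
    moreover have "AE \<omega> in M. real_cond_exp M G (\<lambda>\<omega>. ?I \<omega> * ?X \<omega>) \<omega> = real_cond_exp M G (\<lambda>\<omega>. f 1 * ?I \<omega>) \<omega>"
    proof (rule G.real_cond_exp_cong)
      show "AE \<omega> in M. ?I \<omega> * ?X \<omega> = f 1 * ?I \<omega>"
        using AE1 by eventually_elim (use h in \<open>auto split: split_indicator\<close>)
    qed (use IM Xm in auto)
    moreover have "AE \<omega> in M. real_cond_exp M G (\<lambda>\<omega>. f 1 * ?I \<omega>) \<omega> = f 1 * ?I \<omega>"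
      by (rule G.real_cond_exp_F_meas[OF If]) (use IG in auto)
    ultimately show ?thesis
      using AE1 by eventually_elim auto
  qed

  let ?B = "after_alg t \<tau>"
  \<comment> \<open>On \<open>L\<close> these are the increments from \<open>t\<close> to
    \<open>min (t + h) (\<tau> \<omega>)\<close> and from \<open>t\<close> to
    \<open>\<tau> \<omega>\<close>. The clamp at 0 makes both vanish off \<open>L\<close>, so no
    value before \<open>t\<close> is consulted.\<close>
  define U where "U \<omega> = post_increment (max 0 (min h (\<tau> \<omega> - t))) \<omega>" for \<omega>
  define V where "V \<omega> = post_increment (max 0 (\<tau> \<omega> - t)) \<omega>" for \<omega>
  note Bm = after_alg_measurable
  have UB: "U \<in> borel_measurable ?B" unfolding U_def
    by (rule post_increment_random_time_measurable) (use Bm(2) in auto)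
  have VB: "V \<in> borel_measurable ?B" unfolding V_def
    by (rule post_increment_random_time_measurable) (use Bm(2) in auto)
  define L where "L = {\<omega> \<in> space M. t < \<tau> \<omega>}"
  have LB: "L \<in> sets ?B"
    using Bm(2) unfolding L_def space_after_alg[symmetric] by measurable
  have LM: "L \<in> events" using LB subalgebra_after_alg by (auto simp: subalgebra_def)
  \<comment> \<open>The surrogate for \<open>?z t\<close>: equal to it on \<open>L\<close>, and
    \<open>after_alg\<close>-measurable on the whole space.\<close>
  define z' where "z' \<omega> = \<gamma> t \<omega> / (\<gamma> t \<omega> + V \<omega>)" for \<omega>
  have z'B: "z' \<in> borel_measurable ?B"
    unfolding z'_def using Bm(1) VB by measurable
  have zL: "?z t \<omega> = z' \<omega>" "?z (t + h) \<omega> = (\<gamma> t \<omega> + U \<omega>) / (\<gamma> t \<omega> + V \<omega>)" if "\<omega> \<in> L" for \<omega>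
    using that h by (auto simp: L_def zeta_def z'_def U_def V_def min_def max_def)
  have zLs: "?z s \<omega> = \<gamma> s \<omega> / \<gamma> t \<omega> * z' \<omega>" if "\<omega> \<in> L" "s \<in> {0..t}" for s \<omega>
  proof (cases "\<gamma> t \<omega> = 0")
    \<comment> \<open>By monotonicity \<open>\<gamma> s\<close> vanishes too, so both sides are 0
      under the convention \<open>x / 0 = 0\<close>.\<close>
    case True
    then have "\<gamma> s \<omega> = 0" using that nonneg[of \<omega> s] nondecreasing[of \<omega> s t] by (auto simp: L_def)
    then show ?thesis using that by (simp add: zeta_def L_def)
  next
    case False
    then show ?thesis using that by (simp add: zeta_def L_def z'_def V_def)
  qed

  define W where "W \<omega> = indicator L \<omega> * (?X \<omega> - g \<omega>)" for \<omega>
  have WB: "W \<in> borel_measurable ?B"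
  proof -
    \<comment> \<open>Since \<open>g\<close> is measurable for \<open>?z t\<close>, each preimage
      under \<open>g\<close> is a preimage under \<open>?z t\<close>, and on \<open>L\<close> that
      is a preimage under \<open>z'\<close>. Off \<open>L\<close> the product is 0, whence the case
      distinction on \<open>0 \<in> E\<close>.\<close>
    have gB: "(\<lambda>\<omega>. indicator L \<omega> * g \<omega>) \<in> borel_measurable ?B"
    proof (rule measurableI)
      fix E :: "real set" assume E: "E \<in> sets borel"
      have "g -` E \<inter> space M \<in> sets (gen_sigma M ?z {t})"
        using measurable_sets[OF gG E] by (simp add: G_def)
      then obtain D where D: "D \<in> sets borel" "g -` E \<inter> space M = ?z t -` D \<inter> space M"
        unfolding sets_gen_sigma_singleton by auto
      have "g \<omega> \<in> E \<longleftrightarrow> z' \<omega> \<in> D" if "\<omega> \<in> L" for \<omega>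
      proof -
        have "\<omega> \<in> g -` E \<inter> space M \<longleftrightarrow> \<omega> \<in> ?z t -` D \<inter> space M" by (simp only: D(2))
        then show ?thesis using that zL(1)[OF that] by (simp add: L_def)
      qed
      then have "(\<lambda>\<omega>. indicator L \<omega> * g \<omega>) -` E \<inter> space ?B
          = (L \<inter> (z' -` D \<inter> space ?B)) \<union> (if 0 \<in> E then space ?B - L else {})"
        using sets.sets_into_space[OF LB] by (auto split: if_splits split_indicator split_indicator_asm)
      also have "\<dots> \<in> sets ?B" using LB measurable_sets[OF z'B D(1)] by auto
      finally show "(\<lambda>\<omega>. indicator L \<omega> * g \<omega>) -` E \<inter> space ?B \<in> sets ?B" .
    qed simp
    have "(\<lambda>\<omega>. indicator L \<omega> * f ((\<gamma> t \<omega> + U \<omega>) / (\<gamma> t \<omega> + V \<omega>)) - indicator L \<omega> * g \<omega>) \<in> borel_measurable ?B"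
      using gB LB Bm(1) UB VB f by measurable
    moreover have "W = (\<lambda>\<omega>. indicator L \<omega> * f ((\<gamma> t \<omega> + U \<omega>) / (\<gamma> t \<omega> + V \<omega>)) - indicator L \<omega> * g \<omega>)"
      by (auto simp: W_def zL fun_eq_iff split: split_indicator)
    ultimately show ?thesis by simp
  qed
  have Xg: "integrable M (\<lambda>\<omega>. ?X \<omega> - g \<omega>)" using Xi gi by auto
  have Wi: "integrable M W"
    unfolding W_def using integrable_mult_indicator[OF LM Xg] by simp
  \<comment> \<open>Cutting down to \<open>L\<close> loses nothing: off \<open>L\<close> the terms
    \<open>?X\<close> and \<open>g\<close> are both \<open>f 1\<close> almost surely.\<close>
  have W_AE: "AE \<omega> in M. W \<omega> = ?X \<omega> - g \<omega>"
    using AE1 g1 AE_space by eventually_elim (use h in \<open>auto simp: W_def L_def split: split_indicator\<close>)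

  define G' where "G' = gen_sigma M (\<lambda>_::unit. z') {()}"
  have G'B: "subalgebra ?B G'"
    using sets_gen_sigma_le[of ?B M "{()}" "\<lambda>_. z'"] z'B
    by (simp add: G'_def subalgebra_def space_after_alg)
  define Y where "Y = gen_sigma M (\<lambda>s \<omega>. \<gamma> s \<omega> / \<gamma> t \<omega>) {0..t}"
  have Y: "subalgebra M Y"
    unfolding Y_def
  proof (rule subalgebra_gen_sigma)
    show "(\<lambda>\<omega>. \<gamma> s \<omega> / \<gamma> t \<omega>) \<in> borel_measurable M" if "s \<in> {0..t}" for s
      using that meas[of s] meas[of t] t by auto
  qed
  have zero: "(\<integral>\<omega>\<in>D. W \<omega> \<partial>M) = 0" if "D \<in> sets G'" for D
  proof -
    from that obtain E where E: "E \<in> sets borel" "D = z' -` E \<inter> space M"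
      unfolding G'_def sets_gen_sigma_singleton by auto
    \<comment> \<open>Off \<open>L\<close> the process is almost surely 1, so deleting 1 from
      \<open>E\<close> removes that part, while on \<open>L\<close> the value 1 is almost surely not
      attained. Up to null sets \<open>D'\<close> is thus \<open>D \<inter> L\<close>, yet it is an
      event of \<open>G\<close>, over which \<open>?X\<close> and \<open>g\<close> have equal
      integrals.\<close>
    define D' where "D' = ?z t -` (E - {1}) \<inter> space M"
    have D': "D' \<in> sets G" unfolding G_def D'_def sets_gen_sigma_singleton
      using E(1) by (intro CollectI exI[of _ "E - {1}"]) auto
    have D'M: "D' \<in> events" using D' G.subalg by (auto simp: subalgebra_def)
    have DM: "D \<in> events" using that G'B subalgebra_after_alg by (auto simp: subalgebra_def)
    have "(\<integral>\<omega>\<in>D. W \<omega> \<partial>M) = (\<integral>\<omega>\<in>D'. ?X \<omega> - g \<omega> \<partial>M)"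
      unfolding set_lebesgue_integral_def
    proof (rule integral_cong_AE)
      show "AE \<omega> in M. indicat_real D \<omega> *\<^sub>R W \<omega> = indicat_real D' \<omega> *\<^sub>R (?X \<omega> - g \<omega>)"
        using AE1 AE_space
      proof eventually_elim
        case (elim \<omega>)
        show ?case
        proof (cases "\<omega> \<in> L")
          case True
          then have "?z t \<omega> \<noteq> 1" using elim by (auto simp: L_def)
          then have "\<omega> \<in> D \<longleftrightarrow> \<omega> \<in> D'" using elim zL(1)[OF True] by (auto simp: E D'_def)
          then show ?thesis using True by (simp add: W_def indicator_def)
        next
          case False
          then have "?z t \<omega> = 1" using elim by (auto simp: L_def)
          then have "\<omega> \<notin> D'" by (auto simp: D'_def)
          then show ?thesis using False by (simp add: W_def indicator_def)
        qed
      qed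
    qed (use DM D'M Wi Xg in auto)
    also have "\<dots> = (\<integral>\<omega>\<in>D'. ?X \<omega> \<partial>M) - (\<integral>\<omega>\<in>D'. g \<omega> \<partial>M)"
      by (rule set_integral_diff(2)) (simp_all only: set_integrable_def integrable_mult_indicator[OF D'M] Xi gi)
    also have "\<dots> = 0" unfolding g_def using G.real_cond_exp_intA[OF Xi D'] by simp
    finally show ?thesis .
  qed

  let ?E = "{a \<inter> b | a b. a \<in> sets Y \<and> b \<in> sets G'}"
  define H where "H = sigma (space M) ?E"
  have spY: "space Y = space M" "space G' = space M" by (simp_all add: Y_def G'_def)
  have E_Pow: "?E \<subseteq> Pow (space M)" using sets.sets_into_space[of _ Y] spY by auto
  have H: "space H = space M" "sets H = sigma_sets (space M) ?E"
    unfolding H_def using E_Pow by (auto simp: space_measure_of sets_measure_of)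
  have YH: "sets Y \<subseteq> sets H"
  proof
    fix x assume x: "x \<in> sets Y"
    then have "x = x \<inter> space M" "space M \<in> sets G'"
      using sets.sets_into_space[OF x] sets.top[of G'] spY by auto
    then show "x \<in> sets H" unfolding H using x by (intro sigma_sets.Basic) blast
  qed
  have GH: "sets G' \<subseteq> sets H"
  proof
    fix x assume x: "x \<in> sets G'"
    then have "x = space M \<inter> x" "space M \<in> sets Y"
      using sets.sets_into_space[OF x] sets.top[of Y] spY by auto
    then show "x \<in> sets H" unfolding H using x by (intro sigma_sets.Basic) blast
  qed
  have RH: "(\<lambda>\<omega>. \<gamma> s \<omega> / \<gamma> t \<omega>) \<in> borel_measurable H" if "s \<in> {0..t}" for s
  proof (rule measurable_from_subalg[of H Y])
    show "(\<lambda>\<omega>. \<gamma> s \<omega> / \<gamma> t \<omega>) \<in> borel_measurable Y"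
      unfolding Y_def by (rule measurable_gen_sigma[OF that])
  qed (use YH spY H in \<open>auto simp: subalgebra_def\<close>)
  have z'H: "z' \<in> borel_measurable H"
  proof (rule measurable_from_subalg[of H G'])
    show "z' \<in> borel_measurable G'"
      unfolding G'_def by (rule measurable_gen_sigma[where X="\<lambda>_::unit. z'" and s="()"]) simp
  qed (use GH spY H in \<open>auto simp: subalgebra_def\<close>)

  \<comment> \<open>\<open>F\<close> need not be contained in \<open>H\<close>, because the
    factorisation of \<open>?z s\<close> into a ratio and \<open>z'\<close> holds only on
    \<open>L\<close>. Agreement on \<open>L\<close> is stable under complements and countable
    unions, and it is enough because \<open>W\<close> vanishes elsewhere.\<close>
  have trace: "\<exists>A'\<in>sets H. A \<inter> L = A' \<inter> L" if "A \<in> sets F" for A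
    using that unfolding F_def sets_gen_sigma
  proof (induction rule: sigma_sets.induct)
    case (Basic a)
    then obtain s E where s: "s \<in> {0..t}" and E: "E \<in> sets borel" and a: "a = ?z s -` E \<inter> space M" by auto
    have "(\<lambda>\<omega>. \<gamma> s \<omega> / \<gamma> t \<omega> * z' \<omega>) \<in> borel_measurable H"
      using RH[OF s] z'H by measurable
    from measurable_sets[OF this E]
    have "(\<lambda>\<omega>. \<gamma> s \<omega> / \<gamma> t \<omega> * z' \<omega>) -` E \<inter> space M \<in> sets H" by (simp add: H(1))
    moreover have "a \<inter> L = ((\<lambda>\<omega>. \<gamma> s \<omega> / \<gamma> t \<omega> * z' \<omega>) -` E \<inter> space M) \<inter> L"
      using zLs[OF _ s] by (auto simp: a)
    ultimately show ?case by blast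
  next
    case Empty
    then show ?case by (intro bexI[of _ "{}"]) auto
  next
    case (Compl a)
    then obtain A' where A': "A' \<in> sets H" "a \<inter> L = A' \<inter> L" by blast
    have "space H - A' \<in> sets H" using A' by auto
    moreover have "(space M - a) \<inter> L = (space H - A') \<inter> L" using A'(2) unfolding H(1) by blast
    ultimately show ?case by blast
  next
    case (Union a)
    then have "\<forall>i. \<exists>A'. A' \<in> sets H \<and> a i \<inter> L = A' \<inter> L" by blast
    then obtain A' where A': "\<And>i. A' i \<in> sets H" "\<And>i. a i \<inter> L = A' i \<inter> L" by metis
    have "(\<Union>i. A' i) \<in> sets H" using A' by auto
    moreover have "(\<Union>i. a i) \<inter> L = (\<Union>i. A' i) \<inter> L" using A'(2) by blast
    ultimately show ?case by blast
  qed

  have "AE \<omega> in M. real_cond_exp M F ?X \<omega> = g \<omega>"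
  proof (rule F.real_cond_exp_charact)
    fix A assume A: "A \<in> sets F"
    obtain A' where A': "A' \<in> sets H" "A \<inter> L = A' \<inter> L" using trace[OF A] by blast
    have AM: "A \<in> events" using A F.subalg by (auto simp: subalgebra_def)
    have "(\<integral>\<omega>\<in>A. ?X \<omega> \<partial>M) - (\<integral>\<omega>\<in>A. g \<omega> \<partial>M) = (\<integral>\<omega>\<in>A. ?X \<omega> - g \<omega> \<partial>M)"
      by (rule set_integral_diff(2)[symmetric]) (simp_all only: set_integrable_def integrable_mult_indicator[OF AM] Xi gi)
    also have "\<dots> = (\<integral>\<omega>\<in>A. W \<omega> \<partial>M)"
      unfolding set_lebesgue_integral_def
    proof (rule integral_cong_AE)
      show "AE \<omega> in M. indicat_real A \<omega> *\<^sub>R (?X \<omega> - g \<omega>) = indicat_real A \<omega> *\<^sub>R W \<omega>"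
        using W_AE by eventually_elim simp
    qed (use AM Xg Wi in auto)
    also have "\<dots> = (\<integral>\<omega>\<in>A'. W \<omega> \<partial>M)"
      unfolding set_lebesgue_integral_def
    proof (rule Bochner_Integration.integral_cong[OF refl])
      fix \<omega>
      show "indicat_real A \<omega> *\<^sub>R W \<omega> = indicat_real A' \<omega> *\<^sub>R W \<omega>"
        using A'(2) by (cases "\<omega> \<in> L") (auto simp: W_def indicator_def)
    qed
    also have "\<dots> = 0"
    proof (rule set_integral_zero_indep_enlarge[OF Y subalgebra_after_alg _ G'B WB Wi zero])
      show "indep_set (sets Y) (sets ?B)" unfolding Y_def by (rule ratios_indep_after)
      show "A' \<in> sigma_sets (space M) ?E" using A'(1) unfolding H .
    qed
    finally show "(\<integral>\<omega>\<in>A. ?X \<omega> \<partial>M) = (\<integral>\<omega>\<in>A. g \<omega> \<partial>M)" by simp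
  next
    show "g \<in> borel_measurable F"
      by (rule measurable_from_subalg[OF \<open>subalgebra F G\<close> gG])
  qed (use Xi gi in auto)
  then show ?thesis unfolding F_def G_def g_def .
qed

end

end

theorem mainTheorem7:
  fixes M :: "'a measure" and \<gamma> :: "real \<Rightarrow> 'a \<Rightarrow> real" and \<tau> :: "'a \<Rightarrow> real"
    and f :: "real \<Rightarrow> real" and t h :: real
  assumes gamma: "std_gamma_process M \<gamma>"
    and complete: "complete_measure M"
    and tau_meas: "\<tau> \<in> borel_measurable M"
    and tau_pos: "\<forall>\<omega>\<in>space M. 0 < \<tau> \<omega>"
    and indep: "prob_space.indep_set M (sets (gen_sigma M (\<lambda>_::unit. \<tau>) UNIV))
                  (sets (gen_sigma M \<gamma> {0..}))"
    and f_meas: "f \<in> borel_measurable borel"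
    and f_bdd: "\<exists>C. \<forall>x. \<bar>f x\<bar> \<le> C"
    and t: "0 \<le> t" and h: "0 \<le> h"
  shows "AE \<omega> in M.
    real_cond_exp M (gen_sigma M (zeta \<gamma> \<tau>) {0..t}) (\<lambda>\<omega>. f (zeta \<gamma> \<tau> (t + h) \<omega>)) \<omega>
    = real_cond_exp M (gen_sigma M (zeta \<gamma> \<tau>) {t}) (\<lambda>\<omega>. f (zeta \<gamma> \<tau> (t + h) \<omega>)) \<omega>"
proof -
  interpret gamma_process M \<gamma>
    using gamma by (simp add: gamma_process_def gamma_process_axioms_def std_gamma_process_def)
  show ?thesis
  \<comment> \<open>At time 0 ratios by \<open>\<gamma> t\<close> carry no information, but the
    index sets \<open>{0..0}\<close> and \<open>{0}\<close> coincide, so both sides are the same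
    term.\<close>
  proof (cases "t = 0")
    case False
    then have "0 < t" using t by simp
    from zeta_markov[OF tau_meas indep this tau_pos f_meas f_bdd h] show ?thesis .
  qed simp
qed

end
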